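(* Let $k\ge 1$ and let $1\le s_1<s_2<\ldots<s_k$ be fixed integers with $\gcd(s_1,s_2,\ldots,s_k)=1$. For each integer $n\ge 1$ let $\tau(n)$ be the number of spanning trees in the circulant graph $C_n(s_1,s_2,\ldots,s_k)$ of even valency $2k$. Then the generating function $$F(x)=\sum_{n=1}^{\infty}\tau(n)x^n$$ is a rational function with integer coefficients. Moreover, $F(x)=F(1/x)$.
   Context: The circulant graph $C_n(s_1,\ldots,s_k)$ of even valency has vertex set $\mathbb{Z}_n=\{0,1,\ldots,n-1\}$, and the vertex $i$ is adjacent to the vertices $i\pm s_1,\ldots,i\pm s_k \pmod n$. When $s_k<n/2$ this is a simple $2k$-regular graph. For the finitely many small $n$ with $s_k\ge n/2$, it is understood as the multigraph having one edge joining $i$ and $i+s_j \pmod n$ for each pair $(i,j)$ with $i\in\mathbb{Z}_n$, $1\le j\le k$ (so $nk$ edges in total; loops and multiple edges are allowed, and parallel edges are distinguished when counting spanning trees). For $n=1$ this gives $\tau(1)=1$. The graph is connected if and only if $\gcd(s_1,\ldots,s_k,n)=1$. "$F$ is a rational function with integer coefficients" means that the power series $F(x)$ is the expansion at $x=0$ of a quotient of two polynomials in $\mathbb{Z}[x]$; the identity $F(x)=F(1/x)$ is an identity of rational functions. *)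

theory Defs
  imports "HOL-Computational_Algebra.Computational_Algebra"
begin

section \<open>Undirected multigraphs and spanning trees\<close>

text \<open>
  Edges are names, so that parallel edges are distinguished; \<open>ends e\<close> is the set of the one (loop)
  or two endpoints of \<open>e\<close>. The directed multigraphs of the AFP entry Graph\_Theory are not used,
  because the notion of a tree there forbids only directed cycles.
\<close>

record ('v, 'e) multigraph =
  verts :: "'v set"
  edges :: "'e set"
  ends :: "'e \<Rightarrow> 'v set"

definition joined :: "('v, 'e) multigraph \<Rightarrow> 'e set \<Rightarrow> ('v \<times> 'v) set" where
  "joined G T = {(u, v). \<exists>e\<in>T. ends G e = {u, v}}"

definition connects :: "('v, 'e) multigraph \<Rightarrow> 'e set \<Rightarrow> bool" where
  "connects G T \<longleftrightarrow> (\<forall>u\<in>verts G. \<forall>v\<in>verts G. (u, v) \<in> (joined G T)\<^sup>*)"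

text \<open>
  A cycle of length \<open>m\<close> runs through distinct vertices \<open>vs\<close> along distinct edges \<open>es\<close>. For \<open>m = 1\<close>
  it is a loop, for \<open>m = 2\<close> a pair of parallel edges.
\<close>

definition is_cycle :: "('v, 'e) multigraph \<Rightarrow> 'v list \<Rightarrow> 'e list \<Rightarrow> bool" where
  "is_cycle G vs es \<longleftrightarrow>
     es \<noteq> [] \<and> length vs = length es \<and> distinct vs \<and> distinct es \<and>
     (\<forall>i<length es. ends G (es ! i) = {vs ! i, vs ! (Suc i mod length es)})"

definition acyclic_edges :: "('v, 'e) multigraph \<Rightarrow> 'e set \<Rightarrow> bool" where
  "acyclic_edges G T \<longleftrightarrow> \<not> (\<exists>vs es. is_cycle G vs es \<and> set es \<subseteq> T)"

definition spanning_tree :: "('v, 'e) multigraph \<Rightarrow> 'e set \<Rightarrow> bool" where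
  "spanning_tree G T \<longleftrightarrow> T \<subseteq> edges G \<and> connects G T \<and> acyclic_edges G T"

definition num_spanning_trees :: "('v, 'e) multigraph \<Rightarrow> nat" where
  "num_spanning_trees G = card {T. spanning_tree G T}"

section \<open>Circulant graphs of even valency\<close>

text \<open>
  The jumps are \<open>s 1, \<dots>, s k\<close>. The edge \<open>(i, j)\<close> joins \<open>i\<close> and \<open>i + s j\<close> modulo \<open>n\<close>, so there are
  always \<open>n * k\<close> edges, some of which are loops or parallel if \<open>s k \<ge> n / 2\<close>.
\<close>

definition circulant :: "nat \<Rightarrow> (nat \<Rightarrow> nat) \<Rightarrow> nat \<Rightarrow> (nat, nat \<times> nat) multigraph" where
  "circulant k s n =
     \<lparr>verts = {..<n},
      edges = {..<n} \<times> {1..k},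
      ends = (\<lambda>(i, j). {i, (i + s j) mod n})\<rparr>"

definition tau :: "nat \<Rightarrow> (nat \<Rightarrow> nat) \<Rightarrow> nat \<Rightarrow> nat" where
  "tau k s n = num_spanning_trees (circulant k s n)"

text \<open>The generating function starts at \<open>n = 1\<close>.\<close>

definition tau_gf :: "nat \<Rightarrow> (nat \<Rightarrow> nat) \<Rightarrow> rat fps" where
  "tau_gf k s = Abs_fps (\<lambda>n. if n = 0 then 0 else of_nat (tau k s n))"

section \<open>Rational functions with integer coefficients\<close>

text \<open>
  The condition \<open>coeff Q 0 \<noteq> 0\<close> makes the denominator a unit in the ring of rational power series,
  so the division below is the expansion of \<open>P / Q\<close> at \<open>0\<close>.
\<close>

definition expands_quotient :: "rat fps \<Rightarrow> int poly \<Rightarrow> int poly \<Rightarrow> bool" where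
  "expands_quotient F P Q \<longleftrightarrow>
     coeff Q 0 \<noteq> 0 \<and>
     F = fps_of_poly (map_poly of_int P) / fps_of_poly (map_poly of_int Q)"

text \<open>
  \<open>ratfun P Q r\<close> is the rational function \<open>P / Q\<close> with the element \<open>r\<close> of the field of rational
  functions substituted for the variable. For \<open>r = ratfun_X\<close> this is \<open>P / Q\<close> itself.
\<close>

definition ratfun_X :: "int poly fract" where
  "ratfun_X = Fract [:0, 1:] 1"

definition ratfun :: "int poly \<Rightarrow> int poly \<Rightarrow> int poly fract \<Rightarrow> int poly fract" where
  "ratfun P Q r = poly (map_poly of_int P) r / poly (map_poly of_int Q) r"

end

theory Submission
  imports Defs "Jordan_Normal_Form.Determinant"
begin

text \<open>
  The Laplacian matrix of a circulant graph on \<open>n\<close> vertices is diagonalized by the characters of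
  \<open>\<int>/n\<close>. Its eigenvalue at the character with value \<open>z\<close> at \<open>1\<close>, where \<open>z\<close> is an \<open>n\<close>-th root of
  unity, is the Laurent polynomial \<open>\<Lambda>(z) = \<Sum>\<^sub>t (1 - z\<^bsup>s t\<^esup>) (1 - z\<^bsup>- s t\<^esup>)\<close>, and the matrix-tree theorem says that
  \<open>n \<tau>(n)\<close> is the product of \<open>\<Lambda>(z)\<close> over the \<open>n\<close>-th roots of unity \<open>z \<noteq> 1\<close>
  (\<open>matrix_tree\<close>, \<open>tau_eq_prod_laplacian_eigenvalues\<close>).

  With \<open>S = s k\<close>, the largest jump, \<open>\<Lambda>(z) = - z\<^bsup>-S\<^esup> (z - 1)\<^sup>2 g(z)\<close> for a monic polynomial \<open>g\<close> of even degree
  \<open>2 (S - 1)\<close> with \<open>g(0) = 1\<close> and \<open>g(1) > 0\<close>. Let \<open>a\<^sub>i\<close> be its roots. Since the product of \<open>z - a\<close>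
  over the roots of unity \<open>z \<noteq> 1\<close> is up to sign \<open>(a\<^sup>n - 1) / (a - 1)\<close>, one finds
  \<open>\<tau>(n) = \<plusminus> n \<Prod>\<^sub>i (a\<^sub>i\<^sup>n - 1) / (a\<^sub>i - 1)\<close>, where the sign is \<open>(-1)\<^bsup>(n - 1) (S + 1)\<^esup>\<close>. Expanding the
  product gives \<open>\<tau>(n) = n \<Sum>\<^sub>X c\<^sub>X \<mu>\<^sub>X\<^sup>n\<close>, where \<open>X\<close> runs through the sets of indices and
  \<open>\<mu>\<^sub>X = \<plusminus> \<Prod>\<^bsub>i\<in>X\<^esub> a\<^sub>i\<close> (\<open>tau_exponential_sum\<close>). As \<open>\<Prod>\<^sub>i a\<^sub>i = g(0) = 1\<close> and the
  number of roots is even, replacing \<open>X\<close> by its complement keeps \<open>c\<^sub>X\<close> and inverts \<open>\<mu>\<^sub>X\<close>.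

  The generating function is therefore \<open>\<Sum>\<^sub>X c\<^sub>X \<mu>\<^sub>X x / (1 - \<mu>\<^sub>X x)\<^sup>2\<close>. The substitution of \<open>1/x\<close> for \<open>x\<close>
  turns the term of \<open>X\<close> into that of the complement of \<open>X\<close>, so the function is invariant
  (\<open>symmetric_quotient_of_exponential_sum\<close>).

  This yields a quotient of complex polynomials. To reach integer coefficients, one applies a
  \<open>\<rat>\<close>-linear map \<open>\<complex> \<rightarrow> \<rat>\<close> that fixes \<open>1\<close> to the coefficients of numerator and denominator: the
  relation between them and the rational power series is linear, hence it survives, and so does the
  palindromic symmetry that expresses the invariance under \<open>x \<mapsto> 1/x\<close>
  (\<open>palindromic_quotient_descent\<close>).
\<close>

section \<open>Spanning trees are the connecting edge sets of minimal size\<close>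

lemma joined_sym: "sym (joined G T)"
  by (auto simp: sym_def joined_def insert_commute)

lemma joinedI: "e \<in> T \<Longrightarrow> ends G e = {u, v} \<Longrightarrow> (u, v) \<in> joined G T"
  by (auto simp: joined_def)

lemma connectsI_root:
  assumes "\<And>v. v \<in> verts G \<Longrightarrow> (v, r) \<in> (joined G T)\<^sup>*"
  shows "connects G T"
  unfolding connects_def
proof (intro ballI)
  fix u v assume "u \<in> verts G" "v \<in> verts G"
  moreover have "(r, v) \<in> (joined G T)\<^sup>*"
    using assms[OF \<open>v \<in> verts G\<close>] sym_rtrancl[OF joined_sym] by (metis symD)
  ultimately show "(u, v) \<in> (joined G T)\<^sup>*"
    using assms by (meson rtrancl_trans)
qed

text \<open>
  Every vertex other than the root \<open>r\<close> has an edge to a vertex that is closer to \<open>r\<close>. These parent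
  edges alone connect the graph, and they are distinct: an edge that is the parent edge of
  both its endpoints would have each endpoint closer to \<open>r\<close> than the other.
\<close>

lemma connects_parent_edges:
  assumes r: "r \<in> verts G" and T: "connects G T"
    and ends: "\<And>e. e \<in> T \<Longrightarrow> ends G e \<subseteq> verts G"
  obtains p where "inj_on p (verts G - {r})" "p ` (verts G - {r}) \<subseteq> T"
    "connects G (p ` (verts G - {r}))"
proof -
  \<comment> \<open>The distance from \<open>v\<close> to the root.\<close>
  define d where "d v = (LEAST l. (v, r) \<in> joined G T ^^ l)" for v
  have step: "\<exists>e w. e \<in> T \<and> ends G e = {v, w} \<and> w \<in> verts G \<and> d w < d v"
    if v: "v \<in> verts G - {r}" for v
  proof -
    have "(v, r) \<in> (joined G T)\<^sup>*"
      using v r T by (auto simp: connects_def)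
    then obtain l where "(v, r) \<in> joined G T ^^ l"
      using rtrancl_imp_relpow by blast
    then have dv: "(v, r) \<in> joined G T ^^ d v"
      unfolding d_def by (rule LeastI)
    have "d v \<noteq> 0"
      using dv v by (intro notI) auto
    then obtain l' where l': "d v = Suc l'"
      using not0_implies_Suc by blast
    then obtain w where w: "(v, w) \<in> joined G T" "(w, r) \<in> joined G T ^^ l'"
      using dv relpow_Suc_D2 by metis
    have "d w \<le> l'"
      unfolding d_def by (rule Least_le) (rule w(2))
    moreover obtain e where "e \<in> T" "ends G e = {v, w}"
      using w(1) by (auto simp: joined_def)
    moreover have "w \<in> verts G"
      using ends[OF \<open>e \<in> T\<close>] \<open>ends G e = {v, w}\<close> by auto
    ultimately show ?thesis
      using l' by (metis less_Suc_eq_le)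
  qed
  then obtain p w where p: "\<And>v. v \<in> verts G - {r} \<Longrightarrow>
      p v \<in> T \<and> ends G (p v) = {v, w v} \<and> w v \<in> verts G \<and> d (w v) < d v"
    by metis
  have inj: "inj_on p (verts G - {r})"
  proof (rule inj_onI, rule ccontr)
    fix u v assume uv: "u \<in> verts G - {r}" "v \<in> verts G - {r}" "p u = p v" "u \<noteq> v"
    then have "{u, w u} = {v, w v}"
      using p by metis
    then have "u = w v" "v = w u"
      using \<open>u \<noteq> v\<close> by (auto simp: doubleton_eq_iff)
    then show False
      using p[OF uv(1)] p[OF uv(2)] by auto
  qed
  have "(v, r) \<in> (joined G (p ` (verts G - {r})))\<^sup>*" if "v \<in> verts G" for v
    using that
  proof (induction "d v" arbitrary: v rule: less_induct)
    case (less v)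
    show ?case
    proof (cases "v = r")
      case False
      then have v: "v \<in> verts G - {r}"
        using less.prems by simp
      have "(v, w v) \<in> joined G (p ` (verts G - {r}))"
        using p[OF v] v by (intro joinedI[of "p v"]) auto
      moreover have "(w v, r) \<in> (joined G (p ` (verts G - {r})))\<^sup>*"
        using p[OF v] by (intro less.hyps) auto
      ultimately show ?thesis
        by (rule converse_rtrancl_into_rtrancl)
    qed simp
  qed
  then have "connects G (p ` (verts G - {r}))"
    by (rule connectsI_root)
  with inj p show ?thesis
    by (intro that[of p]) auto
qed

lemma connects_card_ge:
  assumes "r \<in> verts G" "connects G T" "finite T"
    and "\<And>e. e \<in> T \<Longrightarrow> ends G e \<subseteq> verts G"
  shows "card (verts G) - 1 \<le> card T"
proof -
  obtain p where p: "inj_on p (verts G - {r})" "p ` (verts G - {r}) \<subseteq> T"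
    using connects_parent_edges[OF assms(1,2,4)] by metis
  then have "card (verts G - {r}) \<le> card T"
    using assms(3) by (meson card_inj_on_le)
  then show ?thesis
    using assms(1) by (metis card_Diff_singleton)
qed

text \<open>
  A path of minimal length visits distinct vertices, and hence uses distinct edges, so the
  additional edge closes it to a cycle. If \<open>u = v\<close>, the path is empty and the cycle is a loop.
\<close>

lemma cycle_through_edge:
  assumes path: "(u, v) \<in> (joined G T)\<^sup>*" and e: "ends G e = {u, v}" "e \<notin> T"
  obtains vs es where "is_cycle G vs es" "set es \<subseteq> insert e T"
proof -
  define l where "l = (LEAST l. (u, v) \<in> joined G T ^^ l)"
  have "(u, v) \<in> joined G T ^^ l"
    unfolding l_def using rtrancl_imp_relpow[OF path] by (auto intro: LeastI)
  then obtain f where f: "f 0 = u" "f l = v" "\<And>i. i < l \<Longrightarrow> (f i, f (Suc i)) \<in> joined G T"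
    by (auto simp: relpow_fun_conv)
  have seg: "(f a, f (a + c)) \<in> joined G T ^^ c" if "a + c \<le> l" for a c
    using that by (subst relpow_fun_conv) (auto intro!: exI[of _ "\<lambda>i. f (a + i)"] f(3))
  have inj: "f i \<noteq> f j" if ij: "i < j" "j \<le> l" for i j
  proof
    assume "f i = f j"
    have "(u, f i) \<in> joined G T ^^ i"
      using seg[of 0 i] f(1) ij by simp
    moreover have "(f j, v) \<in> joined G T ^^ (l - j)"
      using seg[of j "l - j"] f(2) ij by simp
    ultimately have "(u, v) \<in> joined G T ^^ (i + (l - j))"
      unfolding relpow_add \<open>f i = f j\<close> by auto
    then have "l \<le> i + (l - j)"
      unfolding l_def by (rule Least_le)
    then show False
      using ij by simp
  qed
  obtain g where g: "\<And>i. i < l \<Longrightarrow> g i \<in> T \<and> ends G (g i) = {f i, f (Suc i)}"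
    using f(3) by (simp add: joined_def) metis
  have g_inj: "g i \<noteq> g j" if ij: "i < j" "j < l" for i j
  proof
    assume "g i = g j"
    then have "f i \<in> {f j, f (Suc j)}"
      using g[of i] g[of j] ij by auto
    then show False
      using inj[of i j] inj[of i "Suc j"] ij by auto
  qed
  define vs where "vs = map f [0..<Suc l]"
  define es where "es = map g [0..<l] @ [e]"
  have "inj_on f {0..<Suc l}" "inj_on g {0..<l}"
    using inj g_inj by (auto intro!: linorder_inj_onI)
  then have "distinct vs" "distinct es"
    using g e(2) by (auto simp: vs_def es_def distinct_map simp del: upt_Suc)
  moreover have "ends G (es ! i) = {vs ! i, vs ! (Suc i mod length es)}" if "i < length es" for i
  proof (cases "i = l")
    case True
    then show ?thesis
      using e f by (simp add: es_def vs_def nth_append insert_commute del: upt_Suc)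
  next
    case False
    then have "i < l"
      using that by (simp add: es_def)
    then show ?thesis
      using g by (simp add: es_def vs_def nth_append del: upt_Suc)
  qed
  ultimately have "is_cycle G vs es"
    by (simp add: is_cycle_def vs_def es_def)
  moreover have "set es \<subseteq> insert e T"
    using g by (auto simp: es_def)
  ultimately show ?thesis
    by (rule that)
qed

text \<open>
  The rest of the cycle is a detour around the removed edge.
\<close>

lemma connects_without_cycle_edge:
  assumes T: "connects G T" and cyc: "is_cycle G vs es" "set es \<subseteq> T"
  shows "connects G (T - {last es})"
proof -
  define l where "l = length es - 1"
  let ?R = "joined G (T - {last es})"
  have es: "es \<noteq> []" "length es = Suc l" "distinct es"
    and ends: "\<And>i. i < Suc l \<Longrightarrow> ends G (es ! i) = {vs ! i, vs ! (Suc i mod Suc l)}"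
    using cyc(1) by (auto simp: is_cycle_def l_def)
  have last: "last es = es ! l"
    using es by (simp add: last_conv_nth)
  have path: "(vs ! 0, vs ! i) \<in> ?R\<^sup>*" if "i \<le> l" for i
    using that
  proof (induction i)
    case (Suc i)
    have "es ! i \<in> T - {last es}"
      using Suc.prems es cyc(2) by (auto simp: last nth_eq_iff_index_eq)
    moreover have "ends G (es ! i) = {vs ! i, vs ! Suc i}"
      using ends[of i] Suc.prems by simp
    ultimately have "(vs ! i, vs ! Suc i) \<in> ?R"
      by (rule joinedI)
    with Suc show ?case
      by (meson Suc_leD rtrancl.rtrancl_into_rtrancl)
  qed simp
  have symR: "(y, x) \<in> ?R\<^sup>*" if "(x, y) \<in> ?R\<^sup>*" for x y
    using that sym_rtrancl[OF joined_sym] by (metis symD)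
  have "joined G T \<subseteq> ?R\<^sup>*"
  proof (rule subrelI)
    fix x y assume "(x, y) \<in> joined G T"
    then obtain e where e: "e \<in> T" "ends G e = {x, y}"
      by (auto simp: joined_def)
    show "(x, y) \<in> ?R\<^sup>*"
    proof (cases "e = last es")
      case True
      then have "{x, y} = {vs ! l, vs ! 0}"
        using e(2) ends[of l] last by simp
      then show ?thesis
        using path[of l] symR by (auto simp: doubleton_eq_iff)
    next
      case False
      then show ?thesis
        using e by (intro r_into_rtrancl joinedI[of e]) auto
    qed
  qed
  then have "(joined G T)\<^sup>* \<subseteq> ?R\<^sup>*"
    using rtrancl_subset_rtrancl by blast
  then show ?thesis
    using T by (auto simp: connects_def)
qed

text \<open>
  A connecting set contains the parent edges, one for each vertex but the root. If it has a further
  edge, this edge lies on a cycle; if it has a cycle, an edge can be removed, so it was larger than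
  necessary. This removes cycles from the counting problem, which determinants cannot see directly.
\<close>

lemma spanning_tree_iff_card:
  assumes fin: "finite (edges G)" and r: "r \<in> verts G"
    and ends: "\<And>e. e \<in> edges G \<Longrightarrow> \<exists>u\<in>verts G. \<exists>v\<in>verts G. ends G e = {u, v}"
  shows "spanning_tree G T \<longleftrightarrow>
    T \<subseteq> edges G \<and> connects G T \<and> card T = card (verts G) - 1"
proof -
  have sub: "ends G e \<subseteq> verts G" if "e \<in> edges G" for e
    using ends[OF that] by auto
  have "card T = card (verts G) - 1"
    if T: "T \<subseteq> edges G" "connects G T" "acyclic_edges G T"
  proof -
    obtain p where p: "inj_on p (verts G - {r})" "p ` (verts G - {r}) \<subseteq> T"
        "connects G (p ` (verts G - {r}))"
      using connects_parent_edges[OF r T(2)] sub T(1) by (metis subset_iff)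
    have "T \<subseteq> p ` (verts G - {r})"
    proof (rule subsetI, rule ccontr)
      fix e assume e: "e \<in> T" "e \<notin> p ` (verts G - {r})"
      then obtain u v where uv: "u \<in> verts G" "v \<in> verts G" "ends G e = {u, v}"
        using ends T(1) by blast
      then have "(u, v) \<in> (joined G (p ` (verts G - {r})))\<^sup>*"
        using p(3) by (auto simp: connects_def)
      then obtain vs es where "is_cycle G vs es" "set es \<subseteq> insert e (p ` (verts G - {r}))"
        using cycle_through_edge uv(3) e(2) by metis
      then show False
        using T(3) e(1) p(2) unfolding acyclic_edges_def by blast
    qed
    with p(1,2) have "card T = card (verts G - {r})"
      by (metis card_image subset_antisym)
    then show ?thesis
      using r by (metis card_Diff_singleton)
  qed
  moreover have "acyclic_edges G T"
    if T: "T \<subseteq> edges G" "connects G T" "card T = card (verts G) - 1"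
    unfolding acyclic_edges_def
  proof (rule notI, elim exE conjE)
    fix vs es assume cyc: "is_cycle G vs es" "set es \<subseteq> T"
    have "finite T"
      using T(1) fin by (rule finite_subset)
    have "last es \<in> T"
      using cyc by (auto simp: is_cycle_def)
    moreover have "card (verts G) - 1 \<le> card (T - {last es})"
      using connects_without_cycle_edge[OF T(2) cyc] r T(1) sub \<open>finite T\<close>
      by (intro connects_card_ge) auto
    ultimately show False
      using T(3) \<open>finite T\<close> by (metis card_Diff1_less not_le)
  qed
  ultimately show ?thesis
    by (auto simp: spanning_tree_def)
qed

section \<open>A Cauchy-Binet formula for sums of outer products\<close>

text \<open>
  The matrix \<open>\<Sum>\<^bsub>e\<in>S\<^esub> b\<^sub>e b\<^sub>e\<^sup>T\<close>, truncated to the first \<open>m\<close> coordinates.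
\<close>

definition gram :: "nat \<Rightarrow> ('e \<Rightarrow> nat \<Rightarrow> 'a::comm_ring_1) \<Rightarrow> 'e set \<Rightarrow> 'a mat" where
  "gram m b S = mat m m (\<lambda>(i, j). \<Sum>e\<in>S. b e i * b e j)"

lemma gram_carrier [simp]: "gram m b S \<in> carrier_mat m m"
  by (simp add: gram_def)

lemma det_mat_Leibniz:
  "det (mat m m (\<lambda>(i, j). f i j)) =
    (\<Sum>p | p permutes {0..<m}. signof p * (\<Prod>i\<in>{0..<m}. f i (p i)))"
  unfolding det_def'[OF mat_carrier]
proof (intro sum.cong refl arg_cong2[where f = "(*)"] prod.cong)
  fix p i assume "p \<in> {p. p permutes {0..<m}}" "i \<in> {0..<m}"
  then have "p i < m" "i < m"
    using permutes_in_image[of p "{0..<m}" i] by simp_all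
  then show "mat m m (\<lambda>(i, j). f i j) $$ (i, p i) = f i (p i)"
    by simp
qed

lemma det_scale_rows:
  fixes A :: "'a::comm_ring_1 mat"
  assumes "A \<in> carrier_mat m m"
  shows "det (mat m m (\<lambda>(i, j). c i * A $$ (i, j))) = (\<Prod>i\<in>{0..<m}. c i) * det A"
proof -
  let ?P = "{p. p permutes {0..<m}}"
  have "det (mat m m (\<lambda>(i, j). c i * A $$ (i, j))) =
      (\<Sum>p\<in>?P. signof p * (\<Prod>i\<in>{0..<m}. c i * A $$ (i, p i)))"
    by (rule det_mat_Leibniz)
  also have "\<dots> = prod c {0..<m} * (\<Sum>p\<in>?P. signof p * (\<Prod>i\<in>{0..<m}. A $$ (i, p i)))"
    by (simp add: prod.distrib sum_distrib_left mult.left_commute)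
  finally show ?thesis
    by (simp add: det_def'[OF assms])
qed

text \<open>
  The determinant is multilinear in the rows, so it expands into a sum over all choices of one
  summand \<open>f i\<close> for each row \<open>i\<close>. Two rows that choose the same summand are proportional.
\<close>

lemma det_gram_functions:
  assumes S: "finite S"
  shows "det (gram m b S) =
    (\<Sum>f | f \<in> {0..<m} \<rightarrow>\<^sub>E S \<and> inj_on f {0..<m}. det (mat m m (\<lambda>(i, j). b (f i) i * b (f i) j)))"
proof -
  let ?D = "\<lambda>f. det (mat m m (\<lambda>(i, j). b (f i) i * b (f i) j))"
  let ?P = "{p. p permutes {0..<m}}"
  have fin: "finite ({0..<m} \<rightarrow>\<^sub>E S)"
    using S by (intro finite_PiE) auto
  have "det (gram m b S) =
      (\<Sum>p\<in>?P. signof p * (\<Prod>i\<in>{0..<m}. \<Sum>e\<in>S. b e i * b e (p i)))"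
    unfolding gram_def by (rule det_mat_Leibniz)
  also have "\<dots> = (\<Sum>p\<in>?P. signof p * (\<Sum>f\<in>{0..<m} \<rightarrow>\<^sub>E S. \<Prod>i\<in>{0..<m}. b (f i) i * b (f i) (p i)))"
    using S by (subst prod_sum_PiE) auto
  also have "\<dots> = (\<Sum>f\<in>{0..<m} \<rightarrow>\<^sub>E S. \<Sum>p\<in>?P. signof p * (\<Prod>i\<in>{0..<m}. b (f i) i * b (f i) (p i)))"
    by (simp add: sum_distrib_left) (rule sum.swap)
  also have "\<dots> = (\<Sum>f\<in>{0..<m} \<rightarrow>\<^sub>E S. ?D f)"
    by (simp add: det_mat_Leibniz)
  also have "\<dots> = (\<Sum>f | f \<in> {0..<m} \<rightarrow>\<^sub>E S \<and> inj_on f {0..<m}. ?D f)"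
  proof (rule sum.mono_neutral_right[OF fin])
    show "{f \<in> {0..<m} \<rightarrow>\<^sub>E S. inj_on f {0..<m}} \<subseteq> {0..<m} \<rightarrow>\<^sub>E S"
      by blast
    show "\<forall>f\<in>({0..<m} \<rightarrow>\<^sub>E S) - {f \<in> {0..<m} \<rightarrow>\<^sub>E S. inj_on f {0..<m}}. ?D f = 0"
    proof
      fix f assume "f \<in> ({0..<m} \<rightarrow>\<^sub>E S) - {f \<in> {0..<m} \<rightarrow>\<^sub>E S. inj_on f {0..<m}}"
      then obtain i k where ik: "i < m" "k < m" "i \<noteq> k" "f i = f k"
        by (auto simp: inj_on_def)
      let ?A = "mat m m (\<lambda>(i, j). b (f i) j)"
      have "det ?A = 0"
        using ik by (intro det_identical_rows[of _ m i k]) (auto intro!: eq_vecI)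
      moreover have "mat m m (\<lambda>(i, j). b (f i) i * b (f i) j) =
          mat m m (\<lambda>(i, j). b (f i) i * ?A $$ (i, j))"
        by (intro eq_matI) auto
      ultimately show "?D f = 0"
        using det_scale_rows[of ?A m "\<lambda>i. b (f i) i"] by simp
    qed
  qed
  finally show ?thesis .
qed

text \<open>
  Grouping the injective choices of summands by their image \<open>T\<close> gives the same expansion for \<open>T\<close>
  in place of \<open>S\<close>. This form of the Cauchy-Binet formula avoids minors of rectangular matrices.
\<close>

lemma det_gram:
  assumes S: "finite S"
  shows "det (gram m b S) = (\<Sum>T | T \<subseteq> S \<and> card T = m. det (gram m b T))"
proof -
  let ?D = "\<lambda>f. det (mat m m (\<lambda>(i, j). b (f i) i * b (f i) j))"
  let ?I = "\<lambda>T. {f. f \<in> {0..<m} \<rightarrow>\<^sub>E T \<and> inj_on f {0..<m}}"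
  let ?C = "{T. T \<subseteq> S \<and> card T = m}"
  have fin: "finite (?I S)"
    using S by (intro finite_subset[of "?I S" "{0..<m} \<rightarrow>\<^sub>E S"] finite_PiE) auto
  have finC: "finite ?C"
    using S by (intro finite_subset[of ?C "Pow S"]) auto
  have "det (gram m b S) = sum ?D (?I S)"
    by (rule det_gram_functions[OF S])
  also have "\<dots> = (\<Sum>T\<in>?C. sum ?D {f \<in> ?I S. f ` {0..<m} = T})"
    by (rule sum.group[symmetric, OF fin finC]) (auto simp: card_image PiE_def Pi_def)
  also have "\<dots> = (\<Sum>T\<in>?C. det (gram m b T))"
  proof (intro sum.cong refl)
    fix T assume T: "T \<in> ?C"
    then have "finite T"
      using S finite_subset by blast
    have "{f \<in> ?I S. f ` {0..<m} = T} = ?I T"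
    proof (intro equalityI subsetI)
      fix f assume f: "f \<in> {f \<in> ?I S. f ` {0..<m} = T}"
      then have "f \<in> {0..<m} \<rightarrow> T" "f \<in> extensional {0..<m}" "inj_on f {0..<m}"
        by (blast, simp_all add: PiE_def)
      then show "f \<in> ?I T"
        by (simp add: PiE_def)
    next
      fix f assume "f \<in> ?I T"
      then have f: "f \<in> {0..<m} \<rightarrow>\<^sub>E T" "inj_on f {0..<m}"
        by auto
      then have "f ` {0..<m} \<subseteq> T" "card (f ` {0..<m}) = card T"
        using T by (auto simp: card_image PiE_def Pi_def)
      then have "f ` {0..<m} = T"
        using \<open>finite T\<close> card_subset_eq by blast
      then show "f \<in> {f \<in> ?I S. f ` {0..<m} = T}"
        using f T by (auto simp: PiE_def Pi_def)
    qed
    then show "sum ?D {f \<in> ?I S. f ` {0..<m} = T} = det (gram m b T)"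
      using det_gram_functions[OF \<open>finite T\<close>, of m b] by simp
  qed
  finally show ?thesis .
qed

section \<open>The matrix-tree theorem\<close>

text \<open>
  The column of the incidence matrix that belongs to \<open>e\<close>, for an arbitrary orientation. For a loop it
  is zero.
\<close>

definition incidence :: "('e \<Rightarrow> nat) \<Rightarrow> ('e \<Rightarrow> nat) \<Rightarrow> 'e \<Rightarrow> nat \<Rightarrow> int" where
  "incidence src tgt e i = of_bool (i = src e) - of_bool (i = tgt e)"

text \<open>
  Adding up the incidence vectors along a path telescopes; an edge that is traversed against its
  orientation is counted with the sign \<open>-1\<close>.
\<close>

lemma incidence_span:
  assumes T: "finite T" "\<And>e. e \<in> T \<Longrightarrow> ends G e = {src e, tgt e}"
    and vw: "(v, w) \<in> (joined G T)\<^sup>*"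
  shows "\<exists>c. \<forall>j. (\<Sum>e\<in>T. c e * incidence src tgt e j) = of_bool (j = v) - of_bool (j = w)"
  using vw
proof (induction rule: rtrancl_induct)
  case base
  show ?case by (rule exI[of _ "\<lambda>_. 0"]) simp
next
  case (step x y)
  then obtain c where c: "\<And>j. (\<Sum>e\<in>T. c e * incidence src tgt e j) = of_bool (j = v) - of_bool (j = x)"
    by blast
  obtain d where d: "d \<in> T" "ends G d = {x, y}"
    using step.hyps by (auto simp: joined_def)
  define t :: int where "t = (if src d = x then 1 else -1)"
  have t: "t * incidence src tgt d j = of_bool (j = x) - of_bool (j = y)" for j
    using T(2)[OF d(1)] d(2) by (auto simp: t_def incidence_def doubleton_eq_iff)
  have "(\<Sum>e\<in>T. (c e + (if e = d then t else 0)) * incidence src tgt e j)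
      = of_bool (j = v) - of_bool (j = y)" for j
  proof -
    have "(\<Sum>e\<in>T. (c e + (if e = d then t else 0)) * incidence src tgt e j) =
        (\<Sum>e\<in>T. c e * incidence src tgt e j) + (\<Sum>e\<in>T. if e = d then t * incidence src tgt e j else 0)"
      unfolding sum.distrib[symmetric] by (intro sum.cong) (auto simp: distrib_right)
    also have "\<dots> = (\<Sum>e\<in>T. c e * incidence src tgt e j) + t * incidence src tgt d j"
      using T(1) d(1) by simp
    finally show ?thesis
      using c t by simp
  qed
  then show ?case by (intro exI[of _ "\<lambda>e. c e + (if e = d then t else 0)"] allI)
qed

text \<open>
  Let \<open>B\<close> be the square matrix of the incidence vectors of \<open>T\<close> without the coordinate of the root
  \<open>m\<close>. Paths to the root write each unit vector as an integral combination of the rows of \<open>B\<close>, so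
  \<open>B\<close> has an integral inverse and \<open>det B = \<plusminus>1\<close>. The Gram matrix is \<open>B\<^sup>T B\<close>.
\<close>

lemma det_gram_tree:
  fixes G :: "(nat, 'e) multigraph"
  assumes V: "verts G = {..m}"
    and T: "finite T" "card T = m" "\<And>e. e \<in> T \<Longrightarrow> ends G e = {src e, tgt e}"
    and conn: "connects G T"
  shows "det (gram m (incidence src tgt) T) = 1"
proof -
  let ?b = "incidence src tgt"
  obtain g where g: "bij_betw g {0..<m} T"
    using T(1,2) by (metis ex_bij_betw_nat_finite)
  have "\<exists>c. \<forall>j<m. (\<Sum>e\<in>T. c e * ?b e j) = of_bool (j = v)" if "v < m" for v
  proof -
    have "(v, m) \<in> (joined G T)\<^sup>*"
      using conn V that by (auto simp: connects_def)
    then obtain c where c: "\<And>j. (\<Sum>e\<in>T. c e * ?b e j) = of_bool (j = v) - of_bool (j = m)"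
      using incidence_span[where src=src and tgt=tgt and G=G and T=T and v=v and w=m] T(1,3) by blast
    have "\<forall>j<m. (\<Sum>e\<in>T. c e * ?b e j) = of_bool (j = v)"
      by (simp add: c)
    then show ?thesis by blast
  qed
  then obtain c where c: "\<And>v j. v < m \<Longrightarrow> j < m \<Longrightarrow> (\<Sum>e\<in>T. c v e * ?b e j) = of_bool (j = v)"
    by metis
  define B where "B = mat m m (\<lambda>(i, j). ?b (g i) j)"
  define C where "C = mat m m (\<lambda>(v, i). c v (g i))"
  have carr: "B \<in> carrier_mat m m" "C \<in> carrier_mat m m"
    by (simp_all add: B_def C_def)
  have reindex: "(\<Sum>i = 0..<m. h (g i)) = (\<Sum>e\<in>T. h e)" for h :: "'e \<Rightarrow> int"
    by (rule sum.reindex_bij_betw[OF g])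
  have "C * B = 1\<^sub>m m"
    by (rule eq_matI) (auto simp: B_def C_def scalar_prod_def reindex[of "\<lambda>e. c _ e * ?b e _"] c)
  then have "det C * det B = 1"
    using det_mult[OF carr(2,1)] by simp
  then have "\<bar>det B\<bar> = 1"
    by (metis dvd_triv_right zdvd1_eq)
  moreover have "gram m ?b T = B\<^sup>T * B"
    by (rule eq_matI) (auto simp: gram_def B_def scalar_prod_def reindex[of "\<lambda>e. ?b e _ * ?b e _"])
  then have "det (gram m ?b T) = det B * det B"
    using carr by (simp add: det_mult[of _ m] det_transpose[of _ m])
  ultimately show ?thesis
    by (metis abs_mult_self_eq mult_1)
qed

text \<open>
  The indicator function of the vertices that are not joined to the root \<open>m\<close> is a nonzero vector in
  the kernel: it is constant along every edge and vanishes at the root.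
\<close>

lemma det_gram_disconnected:
  assumes V: "verts G = {..m}"
    and T: "finite T" "\<And>e. e \<in> T \<Longrightarrow> ends G e = {src e, tgt e} \<and> src e \<le> m \<and> tgt e \<le> m"
    and conn: "\<not> connects G T"
  shows "det (gram m (incidence src tgt) T) = 0"
proof -
  let ?b = "incidence src tgt"
  define x :: "nat \<Rightarrow> int" where "x v = of_bool ((v, m) \<notin> (joined G T)\<^sup>*)" for v
  obtain v where v: "v \<le> m" "x v = 1"
    using conn connectsI_root[of G m T] V by (auto simp: x_def)
  \<comment> \<open>Because of this, dropping the coordinate \<open>m\<close> does not change scalar products with \<open>x\<close>.\<close>
  have xm: "x m = 0"
    by (simp add: x_def)
  have "v < m"
    using v xm by (cases "v = m") auto
  have orth: "(\<Sum>j = 0..<m. ?b e j * x j) = 0" if e: "e \<in> T" for e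
  proof -
    have "x (src e) = x (tgt e)"
      using T(2)[OF e] joinedI[OF e, of G "src e" "tgt e"] joinedI[OF e, of G "tgt e" "src e"]
      by (auto simp: x_def insert_commute intro: converse_rtrancl_into_rtrancl)
    have "(\<Sum>j = 0..<m. ?b e j * x j) = (\<Sum>j\<le>m. ?b e j * x j)"
      using xm by (simp add: atLeast0LessThan lessThan_Suc_atMost[symmetric])
    also have "\<dots> = (\<Sum>j\<le>m. if j = src e then x j else 0) - (\<Sum>j\<le>m. if j = tgt e then x j else 0)"
      unfolding sum_subtractf[symmetric] by (intro sum.cong) (auto simp: incidence_def)
    also have "\<dots> = 0"
      using T(2)[OF e] \<open>x (src e) = x (tgt e)\<close> by simp
    finally show ?thesis .
  qed
  have "gram m ?b T *\<^sub>v vec m x = 0\<^sub>v m"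
  proof (rule eq_vecI)
    fix i assume "i < dim_vec (0\<^sub>v m :: int vec)"
    then have "(gram m ?b T *\<^sub>v vec m x) $ i = (\<Sum>j = 0..<m. (\<Sum>e\<in>T. ?b e i * ?b e j) * x j)"
      by (simp add: gram_def scalar_prod_def)
    also have "\<dots> = (\<Sum>e\<in>T. ?b e i * (\<Sum>j = 0..<m. ?b e j * x j))"
      by (simp add: sum_distrib_left sum_distrib_right mult.assoc) (rule sum.swap)
    also have "\<dots> = 0"
      by (simp add: orth)
    finally show "(gram m ?b T *\<^sub>v vec m x) $ i = 0\<^sub>v m $ i"
      using \<open>i < _\<close> by simp
  qed (simp add: gram_def)
  moreover have "vec m x \<noteq> 0\<^sub>v m"
    using v \<open>v < m\<close> by (metis index_vec index_zero_vec(1) zero_neq_one)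
  ultimately show ?thesis
    using det_0_iff_vec_prod_zero[of "gram m ?b T" m] by (auto intro!: exI[of _ "vec m x"])
qed

text \<open>
  Kirchhoff's theorem for the Laplacian matrix from which the row and the column of vertex \<open>m\<close> are
  removed. In the Cauchy-Binet expansion only the edge sets of \<open>m\<close> elements that connect the graph
  survive, each with the value \<open>1\<close>.
\<close>

theorem matrix_tree:
  assumes V: "verts G = {..m}" and fin: "finite (edges G)"
    and E: "\<And>e. e \<in> edges G \<Longrightarrow> ends G e = {src e, tgt e} \<and> src e \<le> m \<and> tgt e \<le> m"
  shows "det (gram m (incidence src tgt) (edges G)) = int (num_spanning_trees G)"
proof -
  let ?C = "{T. T \<subseteq> edges G \<and> card T = m}"
  have finC: "finite ?C"
    using fin by (intro finite_subset[of ?C "Pow (edges G)"]) auto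
  have D: "det (gram m (incidence src tgt) T) = of_bool (connects G T)" if "T \<in> ?C" for T
  proof -
    have T: "finite T" "card T = m" "\<And>e. e \<in> T \<Longrightarrow> ends G e = {src e, tgt e} \<and> src e \<le> m \<and> tgt e \<le> m"
      using that fin E finite_subset by auto
    show ?thesis
      using det_gram_tree[of G m T src tgt] det_gram_disconnected[of G m T src tgt] V T by auto
  qed
  have "det (gram m (incidence src tgt) (edges G)) = (\<Sum>T\<in>?C. of_bool (connects G T))"
    unfolding det_gram[OF fin] by (intro sum.cong D) auto
  also have "\<dots> = int (card {T \<in> ?C. connects G T})"
    using finC by (simp add: sum_of_bool_eq Int_def conj_commute)
  also have "{T. T \<in> ?C \<and> connects G T} = {T. spanning_tree G T}"
  proof (rule Collect_cong)
    fix T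
    have "\<exists>u\<in>verts G. \<exists>v\<in>verts G. ends G e = {u, v}" if "e \<in> edges G" for e
      using E[OF that] V by (intro bexI[of _ "src e"] bexI[of _ "tgt e"]) auto
    then have "spanning_tree G T \<longleftrightarrow> T \<subseteq> edges G \<and> connects G T \<and> card T = card (verts G) - 1"
      using V by (intro spanning_tree_iff_card[OF fin, of m]) auto
    then show "(T \<in> ?C \<and> connects G T) = spanning_tree G T"
      using V by auto
  qed
  finally show ?thesis
    by (simp add: num_spanning_trees_def)
qed

section \<open>Products over roots of unity\<close>

definition primitive_root :: "nat \<Rightarrow> complex \<Rightarrow> bool" where
  "primitive_root n w \<longleftrightarrow> w ^ n = 1 \<and> (\<forall>j. 0 < j \<and> j < n \<longrightarrow> w ^ j \<noteq> 1)"

lemma primitive_root_exists: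
  assumes "n \<ge> 1"
  obtains w where "primitive_root n w"
proof -
  define w where "w = cis (2 * pi / n)"
  have inj: "inj_on (\<lambda>k. cis (2 * pi * real k / real n)) {..<n}"
    using bij_betw_roots_unity[of n] assms by (auto simp: bij_betw_def)
  have pow: "w ^ j = cis (2 * pi * real j / real n)" for j
    by (simp add: w_def DeMoivre mult_ac)
  have "w ^ n = 1"
    using assms by (simp add: pow)
  moreover have "w ^ j \<noteq> 1" if "0 < j" "j < n" for j
  proof
    assume "w ^ j = 1"
    then have "cis (2 * pi * real j / real n) = cis (2 * pi * real 0 / real n)"
      by (simp add: pow)
    then show False
      using inj_onD[OF inj, of j 0] that by auto
  qed
  ultimately show ?thesis
    by (intro that[of w]) (auto simp: primitive_root_def)
qed

lemma primitive_root_nonzero: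
  assumes "primitive_root n w" "n \<ge> 1"
  shows "w \<noteq> 0"
  using assms by (auto simp: primitive_root_def power_0_left)

lemma primitive_root_inj:
  assumes "primitive_root n w" "n \<ge> 1"
  shows "inj_on (\<lambda>j. w ^ j) {..<n}"
proof (rule linorder_inj_onI)
  fix i j assume ij: "i < j" "i \<in> {..<n}" "j \<in> {..<n}"
  then have "w ^ j = w ^ i * w ^ (j - i)"
    by (simp add: power_add[symmetric])
  moreover have "w ^ (j - i) \<noteq> 1"
    using assms ij by (auto simp: primitive_root_def)
  ultimately show "w ^ i \<noteq> w ^ j"
    using primitive_root_nonzero[OF assms] by auto
qed auto

text \<open>
  The factorization of \<open>(x\<^sup>n - 1) / (x - 1)\<close>. It is first proved for polynomials, because cancelling
  \<open>x - 1\<close> is not possible at \<open>x = 1\<close>, and this point is used below.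
\<close>

lemma prod_minus_primitive_powers:
  assumes w: "primitive_root n w" and n: "n \<ge> 1"
  shows "(\<Prod>j\<in>{1..<n}. x - w ^ j) = (\<Sum>i<n. x ^ i)"
proof -
  let ?X = "[:0, 1:] :: complex poly"
  have "(\<Prod>j<n. [:- (w ^ j), 1:]) = ?X ^ n - 1"
  proof (rule poly_eqI_degree_lead_coeff[where n = n and A = "(\<lambda>j. w ^ j) ` {..<n}"])
    have deg: "degree (\<Prod>j<n. [:- (w ^ j), 1:]) = n"
      by (subst degree_prod_eq_sum_degree) auto
    then show "degree (\<Prod>j<n. [:- (w ^ j), 1:]) \<le> n"
      by simp
    have "coeff (\<Prod>j<n. [:- (w ^ j), 1:]) n = 1"
      using lead_coeff_prod[of "\<lambda>j. [:- (w ^ j), 1:]" "{..<n}"] deg by simp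
    moreover have "coeff (?X ^ n) n = 1"
      using lead_coeff_power[of ?X n] by (simp add: degree_power_eq)
    ultimately show "coeff (\<Prod>j<n. [:- (w ^ j), 1:]) n = coeff (?X ^ n - 1) n"
      using n by (simp add: coeff_1)
    show "degree (?X ^ n - 1) \<le> n"
      by (rule degree_diff_le) (simp_all add: degree_power_eq)
    show "n \<le> card ((\<lambda>j. w ^ j) ` {..<n})"
      using card_image[OF primitive_root_inj[OF w n]] by simp
  next
    fix z assume "z \<in> (\<lambda>j. w ^ j) ` {..<n}"
    then obtain j where j: "j < n" "z = w ^ j" by auto
    have "z ^ n = (w ^ n) ^ j"
      unfolding j(2) by (simp add: power_mult[symmetric] mult.commute)
    then have "z ^ n = 1"
      using w by (simp add: primitive_root_def)
    moreover have "(\<Prod>i<n. z - w ^ i) = 0"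
      using j by (auto simp: prod_zero_iff)
    ultimately show "poly (\<Prod>j<n. [:- (w ^ j), 1:]) z = poly (?X ^ n - 1) z"
      by (simp add: poly_prod)
  qed
  moreover have "{..<n} = insert 0 {1..<n}"
    using n by auto
  ultimately have "[:-1, 1:] * (\<Prod>j\<in>{1..<n}. [:- (w ^ j), 1:]) = ?X ^ n - 1"
    by simp
  also have "\<dots> = [:-1, 1:] * (\<Sum>i<n. ?X ^ i)"
    by (subst power_diff_1_eq) (simp add: one_pCons)
  finally have "(\<Prod>j\<in>{1..<n}. [:- (w ^ j), 1:]) = (\<Sum>i<n. ?X ^ i)"
    by (subst (asm) mult_cancel_left) simp
  from arg_cong[OF this, of "\<lambda>p. poly p x"] show ?thesis
    by (simp add: poly_prod poly_sum)
qed

lemma prod_one_minus_primitive_powers: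
  assumes "primitive_root n w" "n \<ge> 1"
  shows "(\<Prod>j\<in>{1..<n}. 1 - w ^ j) = of_nat n"
  using prod_minus_primitive_powers[OF assms, of 1] by simp

lemma prod_primitive_powers:
  assumes "primitive_root n w" "n \<ge> 1"
  shows "(\<Prod>j\<in>{1..<n}. w ^ j) = (-1) ^ (n - 1)"
proof -
  have "(\<Prod>j\<in>{1..<n}. 0 - w ^ j) = (\<Sum>i<n. 0 ^ i)"
    by (rule prod_minus_primitive_powers[OF assms])
  also have "\<dots> = 1"
    using assms(2) by (simp add: power_0_left)
  finally have "(-1) ^ (n - 1) * (\<Prod>j\<in>{1..<n}. w ^ j) = 1"
    by (simp add: prod_uminus)
  then show ?thesis
    by (metis (no_types, opaque_lifting) minus_one_mult_self mult.left_commute mult.right_neutral)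
qed

lemma prod_primitive_powers_minus:
  assumes "primitive_root n w" "n \<ge> 1" "a \<noteq> 1"
  shows "(\<Prod>j\<in>{1..<n}. w ^ j - a) = (-1) ^ (n - 1) * ((a ^ n - 1) / (a - 1))"
proof -
  have "(\<Prod>j\<in>{1..<n}. w ^ j - a) = (\<Prod>j\<in>{1..<n}. - (a - w ^ j))"
    by simp
  also have "\<dots> = (-1) ^ (n - 1) * (\<Prod>j\<in>{1..<n}. a - w ^ j)"
    by (subst prod_uminus) simp
  also have "(\<Prod>j\<in>{1..<n}. a - w ^ j) = (a ^ n - 1) / (a - 1)"
    unfolding prod_minus_primitive_powers[OF assms(1,2)] using assms(3)
    by (simp add: power_diff_1_eq)
  finally show ?thesis .
qed

section \<open>Factorization of the Laplacian eigenvalues\<close>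

text \<open>
  At an \<open>n\<close>-th root of unity \<open>z\<close>, this is the eigenvalue of the Laplacian of the circulant graph for
  the eigenvector \<open>(1, z, \<dots>, z\<^bsup>n - 1\<^esup>)\<close>.
\<close>

definition laplacian_eigenvalue :: "nat \<Rightarrow> (nat \<Rightarrow> nat) \<Rightarrow> complex \<Rightarrow> complex" where
  "laplacian_eigenvalue k s z = (\<Sum>t\<in>{1..k}. (1 - z ^ s t) * (1 - inverse z ^ s t))"

text \<open>
  What remains of the eigenvalue, multiplied by \<open>- z\<^bsup>s k\<^esup>\<close> to make it a polynomial, after division by
  its double zero at \<open>z = 1\<close>. The square comes from
  \<open>(1 - z\<^sup>u) (1 - z\<^bsup>-u\<^esup>) = - z\<^bsup>-u\<^esup> (z\<^sup>u - 1)\<^sup>2\<close>.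
\<close>

definition eigenvalue_quotient :: "nat \<Rightarrow> (nat \<Rightarrow> nat) \<Rightarrow> complex poly" where
  "eigenvalue_quotient k s = (\<Sum>t\<in>{1..k}. monom 1 (s k - s t) * (\<Sum>i<s t. monom 1 i) ^ 2)"

lemma laplacian_eigenvalue_eq_quotient:
  assumes z: "z \<noteq> 0" and mono: "strict_mono_on {1..k} s"
  shows "laplacian_eigenvalue k s z = - (z - 1)\<^sup>2 / z ^ s k * poly (eigenvalue_quotient k s) z"
proof -
  have "(1 - z ^ s t) * (1 - inverse z ^ s t) =
      - (z - 1)\<^sup>2 / z ^ s k * (z ^ (s k - s t) * (\<Sum>i<s t. z ^ i)\<^sup>2)" if t: "t \<in> {1..k}" for t
  proof -
    have "s t \<le> s k"
      using strict_mono_on_leD[OF mono, of t k] t by simp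
    then have "z ^ s k = z ^ s t * z ^ (s k - s t)"
      by (simp add: power_add[symmetric])
    then have "- (z - 1)\<^sup>2 / z ^ s k * (z ^ (s k - s t) * (\<Sum>i<s t. z ^ i)\<^sup>2) =
        - ((z - 1) * (\<Sum>i<s t. z ^ i))\<^sup>2 / z ^ s t"
      using z by (simp add: power_mult_distrib)
    also have "(z - 1) * (\<Sum>i<s t. z ^ i) = z ^ s t - 1"
      by (rule power_diff_1_eq[symmetric])
    also have "- (z ^ s t - 1)\<^sup>2 / z ^ s t = (1 - z ^ s t) * (1 - inverse z ^ s t)"
      using z by (simp add: power_inverse power2_eq_square field_simps)
    finally show ?thesis by simp
  qed
  then show ?thesis
    by (simp add: laplacian_eigenvalue_def eigenvalue_quotient_def poly_sum poly_monom sum_distrib_left)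
qed

lemma geometric_poly:
  fixes q :: nat
  defines "g \<equiv> (\<Sum>i<Suc q. monom (1::complex) i)"
  shows "degree g = q" "lead_coeff g = 1" "coeff g 0 = 1"
proof -
  have c: "coeff g i = of_bool (i \<le> q)" for i
    by (simp add: g_def coeff_sum less_Suc_eq_le del: sum.lessThan_Suc)
  show deg: "degree g = q"
    by (intro antisym degree_le le_degree) (auto simp: c)
  show "lead_coeff g = 1" "coeff g 0 = 1"
    by (simp_all add: deg c)
qed

lemma eigenvalue_quotient_summand:
  fixes u v :: nat
  assumes v: "1 \<le> v" "v \<le> u"
  defines "h \<equiv> monom (1::complex) (u - v) * (\<Sum>i<v. monom 1 i) ^ 2"
  shows "degree h = u + v - 2" "lead_coeff h = 1" "coeff h 0 = of_bool (u = v)"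
proof -
  obtain q where q: "v = Suc q"
    using v(1) by (cases v) auto
  let ?g = "\<Sum>i<Suc q. monom (1::complex) i"
  have h: "h = monom 1 (u - v) * ?g ^ 2"
    by (simp add: h_def q)
  have g0: "?g \<noteq> 0"
    using geometric_poly(3)[of q] by (metis coeff_0 zero_neq_one)
  show "lead_coeff h = 1"
    unfolding h using geometric_poly(2)[of q]
    by (simp only: lead_coeff_mult lead_coeff_power lead_coeff_monom) simp
  have "degree h = (u - v) + 2 * q"
    unfolding h using g0 geometric_poly(1)[of q]
    by (subst degree_mult_eq) (auto simp: degree_monom_eq degree_power_eq monom_eq_0_iff simp del: sum.lessThan_Suc)
  then show "degree h = u + v - 2"
    using v q by simp
  have "coeff (?g ^ 2) 0 = 1"
    using geometric_poly(3)[of q] by (simp add: power2_eq_square coeff_mult_0 del: sum.lessThan_Suc)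
  then show "coeff h 0 = of_bool (u = v)"
    unfolding h using v by (auto simp: coeff_mult_0 simp del: sum.lessThan_Suc)
qed

text \<open>
  Only the summand of the largest jump contributes to the coefficients of the quotient in degrees
  \<open>2 (s k - 1)\<close> and \<open>0\<close>, and there it contributes \<open>1\<close>. Hence the quotient is monic and the product
  of its roots is \<open>1\<close>. At \<open>1\<close> its value is the sum of the squares of the jumps, so \<open>1\<close> is not a root.
\<close>

lemma laplacian_eigenvalue_factorization:
  assumes k: "k \<ge> 1" and s1: "s 1 \<ge> 1" and mono: "strict_mono_on {1..k} s"
  obtains a :: "nat \<Rightarrow> complex" where
    "\<And>z. z \<noteq> 0 \<Longrightarrow> laplacian_eigenvalue k s z = - (z - 1)\<^sup>2 / z ^ s k * (\<Prod>i<2 * (s k - 1). z - a i)"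
    "\<And>i. i < 2 * (s k - 1) \<Longrightarrow> a i \<noteq> 1"
    "(\<Prod>i<2 * (s k - 1). a i) = 1"
proof -
  let ?g = "eigenvalue_quotient k s"
  let ?d = "2 * (s k - 1)"
  let ?h = "\<lambda>t. monom (1::complex) (s k - s t) * (\<Sum>i<s t. monom 1 i) ^ 2"
  have s: "1 \<le> s t" "s t \<le> s k" if "t \<in> {1..k}" for t
    using strict_mono_on_leD[OF mono, of 1 t] strict_mono_on_leD[OF mono, of t k] that s1 by auto
  have s_less: "s t < s k" if "t \<in> {1..k} - {k}" for t
    using strict_mono_onD[OF mono, of t k] that by auto
  have sk: "1 \<le> s k"
    using s[of k] k by simp
  have kin: "k \<in> {1..k}"
    using k by simp
  have deg_le: "degree ?g \<le> ?d"
    unfolding eigenvalue_quotient_def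
  proof (rule degree_sum_le)
    fix t assume t: "t \<in> {1..k}"
    show "degree (?h t) \<le> ?d"
      using eigenvalue_quotient_summand(1)[OF s[OF t]] s[OF t] by simp
  qed simp
  have rest: "coeff (?h t) ?d = 0" "coeff (?h t) 0 = 0" if "t \<in> {1..k} - {k}" for t
  proof -
    have t: "t \<in> {1..k}" using that by simp
    have "degree (?h t) < ?d"
      using eigenvalue_quotient_summand(1)[OF s[OF t]] s[OF t] s_less[OF that] by simp
    then show "coeff (?h t) ?d = 0"
      by (rule coeff_eq_0)
    show "coeff (?h t) 0 = 0"
      using eigenvalue_quotient_summand(3)[OF s[OF t]] s_less[OF that] by simp
  qed
  have coeff_g: "coeff ?g m = coeff (?h k) m" if "\<And>t. t \<in> {1..k} - {k} \<Longrightarrow> coeff (?h t) m = 0" for m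
  proof -
    have "coeff ?g m = coeff (?h k) m + (\<Sum>t\<in>{1..k} - {k}. coeff (?h t) m)"
      unfolding eigenvalue_quotient_def coeff_sum using kin by (intro sum.remove) auto
    then show ?thesis
      using that by simp
  qed
  have lead: "coeff ?g ?d = 1"
  proof -
    have "s k + s k - 2 = ?d"
      using sk by simp
    then have "coeff (?h k) ?d = 1"
      using eigenvalue_quotient_summand(1,2)[OF s[OF kin]] by metis
    then show ?thesis
      using coeff_g[OF rest(1)] by simp
  qed
  have g0: "coeff ?g 0 = 1"
    using eigenvalue_quotient_summand(3)[OF s[OF kin]] coeff_g[OF rest(2)] by simp
  have deg: "degree ?g = ?d"
    using deg_le lead by (metis le_antisym le_degree zero_neq_one)
  have "?g \<noteq> 0"
    using g0 by auto
  then obtain R where R: "size R = degree ?g"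
      "?g = Polynomial.smult (lead_coeff ?g) (\<Prod>x\<in>#R. [:-x, 1:])"
    using alg_closed_imp_factorization by blast
  obtain xs where xs: "mset xs = R"
    using ex_mset by blast
  have len: "length xs = ?d"
    using R(1) deg xs by (metis size_mset)
  define a where "a i = xs ! i" for i
  have "?g = (\<Prod>x\<in>#R. [:-x, 1:])"
    using R(2) deg lead by simp
  also have "\<dots> = prod_list (map (\<lambda>x. [:-x, 1:]) xs)"
    by (simp add: xs[symmetric] prod_mset_prod_list flip: mset_map)
  also have "\<dots> = (\<Prod>i<?d. [:- a i, 1:])"
    by (simp add: prod.list_conv_set_nth len a_def atLeast0LessThan)
  finally have g: "poly ?g z = (\<Prod>i<?d. z - a i)" for z
    by (simp add: poly_prod)
  have "poly ?g 1 = of_nat (\<Sum>t\<in>{1..k}. (s t)\<^sup>2)"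
    by (simp add: eigenvalue_quotient_def poly_sum poly_monom)
  moreover have "(\<Sum>t\<in>{1..k}. (s t)\<^sup>2) \<noteq> 0"
    using kin sk by (subst sum_eq_0_iff) (auto intro!: bexI[of _ k])
  ultimately have "poly ?g 1 \<noteq> 0"
    by (metis of_nat_eq_0_iff)
  then have "a i \<noteq> 1" if "i < ?d" for i
    using that unfolding g by (auto simp: prod_zero_iff)
  moreover have "(\<Prod>i<?d. a i) = 1"
  proof -
    have "(\<Prod>i<?d. 0 - a i) = 1"
      using g[of 0] g0 by (simp add: poly_0_coeff_0)
    then show ?thesis
      by (simp add: prod_uminus power_mult)
  qed
  ultimately show ?thesis
    using laplacian_eigenvalue_eq_quotient[OF _ mono] g by (intro that[of a]) simp_all
qed

text \<open>
  The sign collects one factor \<open>-1\<close> for each \<open>j\<close> and the product of all \<open>(w ^ j) ^ S\<close>. The signs that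
  come from the factors \<open>w ^ j - a i\<close> cancel because the number of these factors is even.
\<close>

lemma prod_over_primitive_powers:
  fixes a :: "nat \<Rightarrow> complex" and d n S :: nat
  assumes w: "primitive_root n w" and n: "n \<ge> 1" and a1: "\<And>i. i < 2 * d \<Longrightarrow> a i \<noteq> 1"
    and eig: "\<And>z. z \<noteq> 0 \<Longrightarrow> f z = - (z - 1)\<^sup>2 / z ^ S * (\<Prod>i<2 * d. z - a i)"
  shows "(\<Prod>j\<in>{1..<n}. f (w ^ j)) =
    (of_nat n)\<^sup>2 * ((-1) ^ (n - 1)) ^ (S + 1) * (\<Prod>i<2 * d. (a i ^ n - 1) / (a i - 1))"
proof -
  let ?J = "{1..<n}"
  define e :: complex where "e = (-1) ^ (n - 1)"
  have e2: "e * e = 1"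
    by (simp add: e_def flip: power_add)
  then have inv_e: "inverse (e ^ S) = e ^ S"
    by (intro inverse_unique) (simp flip: power_mult_distrib)
  have "(\<Prod>j\<in>?J. f (w ^ j)) =
      (\<Prod>j\<in>?J. (-1) * (1 - w ^ j)\<^sup>2 * inverse ((w ^ j) ^ S) * (\<Prod>i<2 * d. w ^ j - a i))"
    using primitive_root_nonzero[OF w n]
    by (intro prod.cong refl) (simp add: eig power2_commute[of "w ^ _"] divide_inverse)
  also have "\<dots> = e * (\<Prod>j\<in>?J. 1 - w ^ j)\<^sup>2 * inverse ((\<Prod>j\<in>?J. w ^ j) ^ S)
      * (\<Prod>i<2 * d. \<Prod>j\<in>?J. w ^ j - a i)"
  proof -
    have "(\<Prod>j\<in>?J. inverse ((w ^ j) ^ S)) = inverse ((\<Prod>j\<in>?J. w ^ j) ^ S)"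
      using prod_inversef[of "\<lambda>j. (w ^ j) ^ S" ?J] by (simp add: o_def prod_power_distrib)
    then show ?thesis
      unfolding prod.distrib prod_power_distrib by (subst prod.swap) (simp add: e_def)
  qed
  also have "(\<Prod>i<2 * d. \<Prod>j\<in>?J. w ^ j - a i) = (\<Prod>i<2 * d. e * ((a i ^ n - 1) / (a i - 1)))"
    unfolding e_def using prod_primitive_powers_minus[OF w n] a1 by (intro prod.cong) auto
  also have "\<dots> = (\<Prod>i<2 * d. (a i ^ n - 1) / (a i - 1))"
    unfolding prod.distrib using e2 by (simp add: power_mult power2_eq_square)
  finally show ?thesis
    unfolding prod_one_minus_primitive_powers[OF w n] prod_primitive_powers[OF w n]
      e_def[symmetric] inv_e by (simp add: mult_ac)
qed

text \<open>
  Expanding \<open>\<Prod>\<^sub>i (a\<^sub>i\<^sup>n - 1)\<close> gives one exponential for each subset \<open>X\<close> of the index set. The products of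
  \<open>a\<close> over \<open>X\<close> and over its complement are inverse to each other, and since the number of indices
  is even, their coefficients have the same sign.
\<close>

lemma exponential_sum_over_subsets:
  fixes a :: "nat \<Rightarrow> complex" and S d :: nat
  assumes a: "(\<Prod>i<2 * d. a i) = 1"
  obtains c \<mu> :: "nat set \<Rightarrow> complex" where
    "\<And>n. n \<ge> 1 \<Longrightarrow> ((-1) ^ (n - 1)) ^ S * (\<Prod>i<2 * d. (a i ^ n - 1) / (a i - 1))
      = (\<Sum>X\<in>Pow {..<2 * d}. c X * \<mu> X ^ n)"
    "\<And>X. X \<subseteq> {..<2 * d} \<Longrightarrow> c ({..<2 * d} - X) = c X"
    "\<And>X. X \<subseteq> {..<2 * d} \<Longrightarrow> \<mu> X * \<mu> ({..<2 * d} - X) = 1"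
proof -
  let ?N = "{..<2 * d}"
  define e :: complex where "e = (-1) ^ S"
  define q where "q = (\<Prod>i\<in>?N. a i - 1)"
  define c where "c X = e * (-1) ^ card (?N - X) / q" for X
  define \<mu> where "\<mu> X = e * (\<Prod>i\<in>X. a i)" for X
  have e2: "e * e = 1"
    by (simp add: e_def flip: power_add)
  show ?thesis
  proof (rule that)
    fix n :: nat assume n: "n \<ge> 1"
    \<comment> \<open>The sign is the \<open>n\<close>-th power of \<open>e\<close> up to a constant, so \<open>\<mu>\<close> can absorb it.\<close>
    have sgn: "((-1) ^ (n - 1)) ^ S = e * e ^ n"
    proof -
      have "((-1) ^ (n - 1)) ^ S = e ^ (n - 1)"
        by (simp add: e_def mult.commute flip: power_mult)
      also have "\<dots> = e * e ^ n"
        using n e2 by (cases n) (simp_all add: mult.assoc[symmetric])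
      finally show ?thesis .
    qed
    have "(\<Prod>i\<in>?N. (a i ^ n - 1) / (a i - 1)) = (\<Prod>i\<in>?N. a i ^ n + (-1)) / q"
      by (simp add: q_def prod_dividef)
    also have "(\<Prod>i\<in>?N. a i ^ n + (-1)) =
        (\<Sum>X\<in>Pow ?N. (\<Prod>i\<in>X. a i) ^ n * (-1) ^ card (?N - X))"
      by (subst prod_add) (simp_all add: prod_power_distrib)
    finally show "((-1) ^ (n - 1)) ^ S * (\<Prod>i\<in>?N. (a i ^ n - 1) / (a i - 1)) =
        (\<Sum>X\<in>Pow ?N. c X * \<mu> X ^ n)"
      unfolding sgn by (simp add: c_def \<mu>_def sum_distrib_left sum_divide_distrib power_mult_distrib mult_ac)
  next
    fix X assume X: "X \<subseteq> ?N"
    then have "finite X" by (rule finite_subset) simp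
    then have "card (?N - X) + card X = 2 * d"
      using X card_mono[of ?N X] by (simp add: card_Diff_subset)
    then have "even (card (?N - X)) \<longleftrightarrow> even (card X)"
      by (metis dvd_triv_left even_add)
    moreover have "?N - (?N - X) = X"
      using X by blast
    ultimately show "c (?N - X) = c X"
      by (simp add: c_def minus_one_power_iff)
    have "\<mu> X * \<mu> (?N - X) = e * e * ((\<Prod>i\<in>?N - X. a i) * (\<Prod>i\<in>X. a i))"
      by (simp add: \<mu>_def mult_ac)
    also have "\<dots> = 1"
      using prod.subset_diff[OF X, of a] a e2 by simp
    finally show "\<mu> X * \<mu> (?N - X) = 1" .
  qed
qed

section \<open>The number of spanning trees as a product of eigenvalues\<close>

text \<open>
  Adding the all-ones matrix replaces the eigenvalue \<open>0\<close> of a Laplacian by \<open>Suc m\<close>, which makes the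
  spectrum usable for the minor in the matrix-tree theorem. Adding all rows to the last one
  and all columns to the last one brings the sum into the form of a product \<open>U * R\<close> of a triangular
  and a block triangular matrix.
\<close>

lemma det_add_all_ones:
  fixes L :: "nat \<Rightarrow> nat \<Rightarrow> 'a::idom"
  assumes rows: "\<And>i. i \<le> m \<Longrightarrow> (\<Sum>j\<le>m. L i j) = 0"
    and cols: "\<And>j. j \<le> m \<Longrightarrow> (\<Sum>i\<le>m. L i j) = 0"
  shows "det (mat (Suc m) (Suc m) (\<lambda>(i, j). L i j + 1)) =
    (of_nat (Suc m))\<^sup>2 * det (mat m m (\<lambda>(i, j). L i j))"
proof -
  let ?n = "Suc m"
  define K where "K = mat ?n ?n (\<lambda>(i, j). L i j + 1)"
  define V :: "'a mat" where "V = mat ?n ?n (\<lambda>(i, j). if i = m \<or> i = j then 1 else 0)"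
  define U :: "'a mat" where "U = mat ?n ?n (\<lambda>(i, j). if j = m then (if i = m then of_nat ?n else 1) else if i = j then 1 else 0)"
  define A where "A = mat m m (\<lambda>(i, j). L i j)"
  define R where "R = four_block_mat A (0\<^sub>m m 1) (mat 1 m (\<lambda>_. 1)) (mat 1 1 (\<lambda>_. of_nat ?n))"
  have carr: "K \<in> carrier_mat ?n ?n" "V \<in> carrier_mat ?n ?n" "U \<in> carrier_mat ?n ?n"
      "V\<^sup>T \<in> carrier_mat ?n ?n" "A \<in> carrier_mat m m"
    by (simp_all add: K_def V_def U_def A_def)
  have R: "R \<in> carrier_mat ?n ?n"
    using four_block_carrier_mat[of A m m "mat 1 1 (\<lambda>_. of_nat ?n)" 1 1] carr(5) by (simp add: R_def)
  have R_entry: "R $$ (i, j) = (if i < m then (if j < m then L i j else 0) else if j < m then 1 else of_nat ?n)"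
    if "i < ?n" "j < ?n" for i j
    using that by (auto simp: R_def A_def)
  have VK: "V * K = mat ?n ?n (\<lambda>(i, j). if i = m then of_nat ?n else L i j + 1)" (is "_ = ?VK")
  proof (rule eq_matI)
    fix i j assume "i < dim_row ?VK" "j < dim_col ?VK"
    then have ij: "i < ?n" "j < ?n" by simp_all
    have "(V * K) $$ (i, j) = (\<Sum>l\<le>m. (if i = m \<or> i = l then 1 else 0) * (L l j + 1))"
      using ij by (simp add: V_def K_def scalar_prod_def atLeast0LessThan lessThan_Suc_atMost)
    also have "\<dots> = (if i = m then of_nat ?n else L i j + 1)"
    proof (cases "i = m")
      case True
      then show ?thesis
        using cols[of j] ij by (simp add: sum.distrib)
    next
      case False
      then have "(\<Sum>l\<le>m. (if i = m \<or> i = l then 1 else 0) * (L l j + 1)) =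
          (\<Sum>l\<le>m. if i = l then L l j + 1 else 0)"
        by (intro sum.cong) auto
      then show ?thesis
        using False ij by simp
    qed
    finally show "(V * K) $$ (i, j) = ?VK $$ (i, j)"
      using ij by simp
  qed (simp_all add: V_def K_def)
  have VKV: "V * K * V\<^sup>T = U * R"
  proof (rule eq_matI)
    fix i j assume "i < dim_row (U * R)" "j < dim_col (U * R)"
    then have ij: "i < ?n" "j < ?n"
      using R carr by simp_all
    have "(V * K * V\<^sup>T) $$ (i, j) =
        (\<Sum>l\<le>m. (if i = m then of_nat ?n else L i l + 1) * (if j = m \<or> j = l then 1 else 0))"
      unfolding VK using ij by (simp add: V_def scalar_prod_def atLeast0LessThan lessThan_Suc_atMost)
    also have "\<dots> = (if j = m then (if i = m then of_nat ?n * of_nat ?n else of_nat ?n)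
        else if i = m then of_nat ?n else L i j + 1)"
    proof (cases "j = m")
      case True
      then show ?thesis
        using rows[of i] ij by (simp add: sum.distrib)
    next
      case False
      then have "(\<Sum>l\<le>m. (if i = m then of_nat ?n else L i l + 1) * (if j = m \<or> j = l then 1 else 0)) =
          (\<Sum>l\<le>m. if j = l then (if i = m then of_nat ?n else L i l + 1) else 0)"
        by (intro sum.cong) auto
      then show ?thesis
        using False ij by simp
    qed
    also have "\<dots> = (\<Sum>l\<in>{0..<m}. (if i = l then 1 else 0) * R $$ (l, j)) +
        (if i = m then of_nat ?n else 1) * R $$ (m, j)"
    proof -
      have "(\<Sum>l\<in>{0..<m}. (if i = l then 1 else 0) * R $$ (l, j)) =
          (\<Sum>l\<in>{0..<m}. if i = l then R $$ (l, j) else 0)"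
        by (intro sum.cong) auto
      then show ?thesis
        using ij by (auto simp: R_entry)
    qed
    also have "\<dots> = (U * R) $$ (i, j)"
      using ij R by (simp add: U_def scalar_prod_def)
    finally show "(V * K * V\<^sup>T) $$ (i, j) = (U * R) $$ (i, j)" .
  qed (use carr R in simp_all)
  have detV: "det V = 1"
    by (subst det_lower_triangular[OF _ carr(2)])
      (auto simp: V_def prod_list_diag_prod)
  have detU: "det U = of_nat ?n"
    by (subst det_upper_triangular[OF _ carr(3)])
      (auto simp: U_def prod_list_diag_prod upper_triangular_def)
  have detR: "det R = det A * of_nat ?n"
    unfolding R_def using carr(5)
    by (subst det_four_block_mat_upper_right_zero_col[of _ m]) (auto simp: det_single)
  have "det (V * K * V\<^sup>T) = det V * det K * det V"
    using det_mult[OF mult_carrier_mat[OF carr(2,1)] carr(4)] det_mult[OF carr(2,1)]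
      det_transpose[OF carr(2)] by simp
  then have "det K = of_nat ?n * (det A * of_nat ?n)"
    unfolding VKV det_mult[OF carr(3) R] detU detR detV by simp
  then show ?thesis
    by (simp add: K_def A_def power2_eq_square mult_ac)
qed

text \<open>
  The matrix \<open>F\<close> of eigenvectors is the discrete Fourier transform. The orthogonality of characters
  shows that it is invertible.
\<close>

lemma det_eigenvectors:
  fixes K :: "complex mat"
  assumes K: "K \<in> carrier_mat n n" and w: "primitive_root n w" and n: "n \<ge> 1"
    and eig: "\<And>a j. a < n \<Longrightarrow> j < n \<Longrightarrow> (\<Sum>c<n. K $$ (a, c) * (w ^ j) ^ c) = l j * (w ^ j) ^ a"
  shows "det K = (\<Prod>j<n. l j)"
proof -
  define F where "F = mat n n (\<lambda>(i, j). (w ^ j) ^ i)"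
  define G where "G = mat n n (\<lambda>(i, j). inverse ((w ^ i) ^ j))"
  define D where "D = mat n n (\<lambda>(i, j). if i = j then l j else 0)"
  have carr: "F \<in> carrier_mat n n" "G \<in> carrier_mat n n" "D \<in> carrier_mat n n"
    by (simp_all add: F_def G_def D_def)
  have w0: "w \<noteq> 0"
    by (rule primitive_root_nonzero[OF w n])
  have "G * F = of_nat n \<cdot>\<^sub>m 1\<^sub>m n"
  proof (rule eq_matI)
    fix i j assume "i < dim_row (of_nat n \<cdot>\<^sub>m 1\<^sub>m n :: complex mat)" "j < dim_col (of_nat n \<cdot>\<^sub>m 1\<^sub>m n :: complex mat)"
    then have ij: "i < n" "j < n" by simp_all
    define x where "x = inverse (w ^ i) * w ^ j"
    have "(G * F) $$ (i, j) = (\<Sum>c<n. x ^ c)"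
      using ij by (simp add: G_def F_def scalar_prod_def atLeast0LessThan x_def power_mult_distrib power_inverse)
    also have "\<dots> = (if i = j then of_nat n else 0)"
    proof (cases "i = j")
      case True
      then show ?thesis using w0 by (simp add: x_def)
    next
      case False
      then have "w ^ i \<noteq> w ^ j"
        using inj_onD[OF primitive_root_inj[OF w n], of i j] ij by auto
      then have "x \<noteq> 1"
        using w0 by (auto simp: x_def field_simps)
      have wn: "(w ^ l) ^ n = 1" for l
        using w by (metis mult.commute power_mult power_one primitive_root_def)
      then have "x ^ n = 1"
        by (simp add: x_def power_mult_distrib power_inverse)
      then show ?thesis
        using \<open>x \<noteq> 1\<close> False power_diff_1_eq[of x n] by simp
    qed
    finally show "(G * F) $$ (i, j) = (of_nat n \<cdot>\<^sub>m 1\<^sub>m n) $$ (i, j)"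
      using ij by simp
  qed (simp_all add: F_def G_def)
  then have "det G * det F = of_nat n ^ n"
    using det_mult[OF carr(2,1)] by simp
  then have F0: "det F \<noteq> 0"
    using n by auto
  have "K * F = F * D"
  proof (rule eq_matI)
    fix a j assume "a < dim_row (F * D)" "j < dim_col (F * D)"
    then have aj: "a < n" "j < n" by (simp_all add: F_def D_def)
    have "(K * F) $$ (a, j) = (\<Sum>c<n. K $$ (a, c) * (w ^ j) ^ c)"
      using aj K by (simp add: F_def scalar_prod_def atLeast0LessThan)
    also have "\<dots> = (w ^ j) ^ a * l j"
      using eig[OF aj] by simp
    also have "\<dots> = (\<Sum>c<n. (w ^ c) ^ a * (if c = j then l j else 0))"
      using aj by (simp add: if_distrib[of "(*) _"] cong: if_cong)
    also have "\<dots> = (F * D) $$ (a, j)"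
      using aj by (simp add: F_def D_def scalar_prod_def atLeast0LessThan)
    finally show "(K * F) $$ (a, j) = (F * D) $$ (a, j)" .
  qed (use K in \<open>simp_all add: F_def D_def\<close>)
  then have "det F * det K = det F * det D"
    using det_mult[OF K carr(1)] det_mult[OF carr(1,3)] by (metis mult.commute)
  then have "det K = det D"
    using F0 by (simp only: mult_cancel_left) simp
  also have "\<dots> = (\<Prod>j<n. l j)"
    by (subst det_upper_triangular[OF _ carr(3)])
      (auto simp: D_def prod_list_diag_prod upper_triangular_def atLeast0LessThan)
  finally show ?thesis .
qed

text \<open>
  Edges of a circulant graph are oriented from \<open>fst e\<close> to this endpoint.
\<close>

definition jump_target :: "(nat \<Rightarrow> nat) \<Rightarrow> nat \<Rightarrow> nat \<times> nat \<Rightarrow> nat" where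
  "jump_target s n = (\<lambda>(i, t). (i + s t) mod n)"

lemma rotation_bij:
  fixes n u :: nat
  assumes "n \<ge> 1"
  shows "bij_betw (\<lambda>i. (i + u) mod n) {..<n} {..<n}"
proof -
  have "inj_on (\<lambda>i. (i + u) mod n) {..<n}"
  proof (rule inj_onI)
    fix i j assume ij: "i \<in> {..<n}" "j \<in> {..<n}" "(i + u) mod n = (j + u) mod n"
    have "(int i + int u) mod int n = (int j + int u) mod int n"
      using arg_cong[OF ij(3), of int] by (simp add: of_nat_mod)
    then have "int i mod int n = int j mod int n"
      unfolding mod_eq_dvd_iff by simp
    then show "i = j"
      using ij(1,2) by simp
  qed
  moreover have "(\<lambda>i. (i + u) mod n) ` {..<n} \<subseteq> {..<n}"
    using assms by auto
  ultimately show ?thesis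
    by (simp add: bij_betw_def endo_inj_surj)
qed

text \<open>
  With \<open>L = \<Sum>\<^sub>e b\<^sub>e b\<^sub>e\<^sup>T\<close>, the product of \<open>L\<close> and \<open>(z\<^sup>c)\<^sub>c\<close> is computed as \<open>\<Sum>\<^sub>e b\<^sub>e \<langle>b\<^sub>e, (z\<^sup>c)\<^sub>c\<rangle>\<close>. For the edge
  \<open>(i, t)\<close> the scalar product is \<open>z\<^sup>i (1 - z\<^bsup>s t\<^esup>)\<close>. Summing \<open>b\<^sub>e z\<^sup>i\<close> over the edges of jump \<open>t\<close> gives the
  second factor \<open>1 - z\<^bsup>- s t\<^esup>\<close>, as the targets of these edges run through all vertices.
\<close>

lemma circulant_eigenvector:
  fixes z :: complex
  assumes n: "n \<ge> 1" and z: "z ^ n = 1" and a: "a < n"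
  shows "(\<Sum>c<n. (\<Sum>e\<in>{..<n} \<times> {1..k}. of_int (incidence fst (jump_target s n) e a
      * incidence fst (jump_target s n) e c)) * z ^ c) = laplacian_eigenvalue k s z * z ^ a"
proof -
  let ?b = "\<lambda>e c. of_int (incidence fst (jump_target s n) e c) :: complex"
  have z0: "z \<noteq> 0"
    using z n by (auto simp: power_0_left)
  have zmod: "z ^ (l mod n) = z ^ l" for l
  proof -
    have "z ^ l = z ^ (n * (l div n) + l mod n)" by simp
    also have "\<dots> = z ^ (l mod n)"
      by (simp only: power_add power_mult z power_one mult_1)
    finally show ?thesis by simp
  qed
  have inner: "(\<Sum>c<n. ?b (i, t) c * z ^ c) = z ^ i * (1 - z ^ s t)" if "i < n" for i t
  proof -
    have "(\<Sum>c<n. ?b (i, t) c * z ^ c) =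
        (\<Sum>c<n. (if c = i then z ^ c else 0) - (if c = (i + s t) mod n then z ^ c else 0))"
      by (intro sum.cong) (auto simp: incidence_def jump_target_def)
    also have "\<dots> = z ^ i - z ^ ((i + s t) mod n)"
      using that n by (simp add: sum_subtractf)
    finally show ?thesis
      by (simp add: zmod power_add algebra_simps)
  qed
  have outer: "(\<Sum>i<n. ?b (i, t) a * z ^ i) = z ^ a * (1 - inverse z ^ s t)" for t
  proof -
    let ?h = "\<lambda>x. (if x = a then z ^ x else 0) * inverse z ^ s t"
    have "(\<Sum>i<n. ?b (i, t) a * z ^ i) =
        (\<Sum>i<n. (if i = a then z ^ i else 0) - ?h ((i + s t) mod n))"
    proof (intro sum.cong refl)
      fix i
      have "z ^ ((i + s t) mod n) * inverse z ^ s t = z ^ i"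
        using z0 by (simp add: zmod power_add power_inverse)
      then show "?b (i, t) a * z ^ i = (if i = a then z ^ i else 0) - ?h ((i + s t) mod n)"
        by (auto simp: incidence_def jump_target_def)
    qed
    also have "\<dots> = z ^ a - (\<Sum>i<n. ?h ((i + s t) mod n))"
      using a by (simp add: sum_subtractf)
    also have "(\<Sum>i<n. ?h ((i + s t) mod n)) = (\<Sum>x<n. ?h x)"
      by (rule sum.reindex_bij_betw[OF rotation_bij[OF n]])
    also have "\<dots> = z ^ a * inverse z ^ s t"
      using a by (simp flip: sum_distrib_right)
    finally show ?thesis
      by (simp add: algebra_simps)
  qed
  have "(\<Sum>c<n. (\<Sum>e\<in>{..<n} \<times> {1..k}. ?b e a * ?b e c) * z ^ c) =
      (\<Sum>e\<in>{..<n} \<times> {1..k}. ?b e a * (\<Sum>c<n. ?b e c * z ^ c))"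
    by (simp add: sum_distrib_left sum_distrib_right mult.assoc) (rule sum.swap)
  also have "\<dots> = (\<Sum>(i, t)\<in>{..<n} \<times> {1..k}. (1 - z ^ s t) * (?b (i, t) a * z ^ i))"
    by (intro sum.cong) (auto simp: inner)
  also have "\<dots> = (\<Sum>t\<in>{1..k}. (1 - z ^ s t) * (\<Sum>i<n. ?b (i, t) a * z ^ i))"
    unfolding sum.cartesian_product[symmetric] by (subst sum.swap) (simp add: sum_distrib_left)
  also have "\<dots> = laplacian_eigenvalue k s z * z ^ a"
    unfolding outer by (simp add: laplacian_eigenvalue_def sum_distrib_left mult_ac)
  finally show ?thesis by simp
qed

text \<open>
  The determinant of \<open>L\<close> plus the all-ones matrix is \<open>n\<^sup>2 \<tau>(n)\<close> by the matrix-tree theorem and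
  \<open>n\<close> times the product of the eigenvalues at \<open>w ^ j\<close> for \<open>0 < j < n\<close> by diagonalization: the
  constant vector has eigenvalue \<open>n\<close>, and on the other characters the all-ones matrix vanishes.
\<close>

theorem tau_eq_prod_laplacian_eigenvalues:
  assumes n: "n \<ge> 1" and w: "primitive_root n w"
  shows "of_nat n * of_nat (tau k s n) = (\<Prod>j\<in>{1..<n}. laplacian_eigenvalue k s (w ^ j))"
proof -
  obtain m where m: "n = Suc m"
    using n by (cases n) auto
  let ?G = "circulant k s n"
  let ?E = "{..<n} \<times> {1..k}"
  let ?b = "incidence fst (jump_target s n)"
  define L where "L i j = (\<Sum>e\<in>?E. ?b e i * ?b e j)" for i j
  have tgt: "fst e \<le> m" "jump_target s n e \<le> m" if "e \<in> ?E" for e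
    using that by (auto simp: m jump_target_def less_Suc_eq_le[symmetric])
  have "det (gram m ?b (edges ?G)) = int (num_spanning_trees ?G)"
    by (rule matrix_tree)
      (auto simp: circulant_def m jump_target_def less_Suc_eq_le[symmetric])
  then have tau: "int (tau k s n) = det (mat m m (\<lambda>(i, j). L i j))"
    by (simp add: tau_def gram_def L_def circulant_def)
  have zero: "(\<Sum>j\<le>m. ?b e j) = 0" if "e \<in> ?E" for e
    using tgt[OF that] by (simp add: incidence_def sum_subtractf of_bool_def)
  have "(\<Sum>j\<le>m. L i j) = 0" for i
  proof -
    have "(\<Sum>j\<le>m. L i j) = (\<Sum>e\<in>?E. ?b e i * (\<Sum>j\<le>m. ?b e j))"
      unfolding L_def sum_distrib_left by (rule sum.swap)
    then show ?thesis
      using zero by simp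
  qed
  moreover have "L i j = L j i" for i j
    by (simp add: L_def mult.commute)
  ultimately have "det (mat n n (\<lambda>(i, j). L i j + 1)) = (int n)\<^sup>2 * int (tau k s n)"
    unfolding tau unfolding m by (intro det_add_all_ones) auto
  then have 1: "det (map_mat of_int (mat n n (\<lambda>(i, j). L i j + 1)) :: complex mat)
      = (of_nat n)\<^sup>2 * of_nat (tau k s n)"
    by (simp add: of_int_hom.hom_det)
  have "det (map_mat of_int (mat n n (\<lambda>(i, j). L i j + 1)) :: complex mat)
      = (\<Prod>j<n. laplacian_eigenvalue k s (w ^ j) + (if j = 0 then of_nat n else 0))"
  proof (rule det_eigenvectors[OF _ w n])
    fix a j assume aj: "a < n" "j < n"
    have zn: "(w ^ j) ^ n = 1"
      using w by (metis mult.commute power_mult power_one primitive_root_def)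
    have geo: "(\<Sum>c<n. (w ^ j) ^ c) = (if j = 0 then of_nat n else 0)"
    proof (cases "j = 0")
      case False
      then have "w ^ j \<noteq> 1"
        using w aj by (auto simp: primitive_root_def)
      then show ?thesis
        using power_diff_1_eq[of "w ^ j" n] zn False by simp
    qed simp
    have "(\<Sum>c<n. map_mat of_int (mat n n (\<lambda>(i, j). L i j + 1)) $$ (a, c) * (w ^ j) ^ c) =
        (\<Sum>c<n. (\<Sum>e\<in>?E. of_int (?b e a * ?b e c)) * (w ^ j) ^ c) + (\<Sum>c<n. (w ^ j) ^ c)"
      unfolding sum.distrib[symmetric]
      by (intro sum.cong refl) (use aj in \<open>simp add: L_def distrib_right\<close>)
    also have "\<dots> = laplacian_eigenvalue k s (w ^ j) * (w ^ j) ^ a + (if j = 0 then of_nat n else 0)"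
      unfolding geo circulant_eigenvector[OF n zn aj(1)] ..
    also have "\<dots> = (laplacian_eigenvalue k s (w ^ j) + (if j = 0 then of_nat n else 0)) * (w ^ j) ^ a"
      by (simp add: distrib_right)
    finally show "(\<Sum>c<n. map_mat of_int (mat n n (\<lambda>(i, j). L i j + 1)) $$ (a, c) * (w ^ j) ^ c) =
      (laplacian_eigenvalue k s (w ^ j) + (if j = 0 then of_nat n else 0)) * (w ^ j) ^ a" .
  qed simp
  also have "{..<n} = insert 0 {1..<n}"
    using n by auto
  also have "(\<Prod>j\<in>insert 0 {1..<n}. laplacian_eigenvalue k s (w ^ j) + (if j = 0 then of_nat n else 0)) =
      of_nat n * (\<Prod>j\<in>{1..<n}. laplacian_eigenvalue k s (w ^ j))"
    by (simp add: laplacian_eigenvalue_def)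
  finally show ?thesis
    using 1 n by (simp add: power2_eq_square)
qed

text \<open>
  The set \<open>N\<close> indexes the roots of the eigenvalues that differ from \<open>1\<close>. The factor \<open>n\<close> is what
  remains of the contribution \<open>n\<^sup>2\<close> of the double root \<open>1\<close> after division by \<open>n\<close>.
\<close>

theorem tau_exponential_sum:
  fixes s :: "nat \<Rightarrow> nat"
  assumes k: "k \<ge> 1" and s1: "s 1 \<ge> 1" and mono: "strict_mono_on {1..k} s"
  obtains c \<mu> :: "nat set \<Rightarrow> complex" and N :: "nat set" where "finite N"
    "\<And>n. n \<ge> 1 \<Longrightarrow> of_nat (tau k s n) = of_nat n * (\<Sum>X\<in>Pow N. c X * \<mu> X ^ n)"
    "\<And>X. X \<subseteq> N \<Longrightarrow> c (N - X) = c X"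
    "\<And>X. X \<subseteq> N \<Longrightarrow> \<mu> X * \<mu> (N - X) = 1"
proof -
  obtain a where eig: "\<And>z. z \<noteq> 0 \<Longrightarrow>
        laplacian_eigenvalue k s z = - (z - 1)\<^sup>2 / z ^ s k * (\<Prod>i<2 * (s k - 1). z - a i)"
      and a1: "\<And>i. i < 2 * (s k - 1) \<Longrightarrow> a i \<noteq> 1"
      and a: "(\<Prod>i<2 * (s k - 1). a i) = 1"
    using laplacian_eigenvalue_factorization[OF assms] by blast
  obtain c \<mu> :: "nat set \<Rightarrow> complex" where c:
      "\<And>n. n \<ge> 1 \<Longrightarrow> ((-1) ^ (n - 1)) ^ (s k + 1) * (\<Prod>i<2 * (s k - 1). (a i ^ n - 1) / (a i - 1))
        = (\<Sum>X\<in>Pow {..<2 * (s k - 1)}. c X * \<mu> X ^ n)"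
      "\<And>X. X \<subseteq> {..<2 * (s k - 1)} \<Longrightarrow> c ({..<2 * (s k - 1)} - X) = c X"
      "\<And>X. X \<subseteq> {..<2 * (s k - 1)} \<Longrightarrow> \<mu> X * \<mu> ({..<2 * (s k - 1)} - X) = 1"
    using exponential_sum_over_subsets[OF a, of "s k + 1"] by blast
  have "of_nat (tau k s n) = of_nat n * (\<Sum>X\<in>Pow {..<2 * (s k - 1)}. c X * \<mu> X ^ n)"
    if n: "n \<ge> 1" for n
  proof -
    obtain w where w: "primitive_root n w"
      using primitive_root_exists[OF n] by blast
    have "of_nat n * of_nat (tau k s n) =
        (of_nat n)\<^sup>2 * ((-1) ^ (n - 1)) ^ (s k + 1) * (\<Prod>i<2 * (s k - 1). (a i ^ n - 1) / (a i - 1))"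
      unfolding tau_eq_prod_laplacian_eigenvalues[OF n w] by (rule prod_over_primitive_powers[OF w n a1 eig])
    also have "\<dots> = of_nat n * (of_nat n * (\<Sum>X\<in>Pow {..<2 * (s k - 1)}. c X * \<mu> X ^ n))"
      unfolding c(1)[OF n, symmetric] by (simp only: power2_eq_square mult.assoc)
    finally show ?thesis
      using n by (simp only: mult_cancel_left) simp
  qed
  then show ?thesis
    using c(2,3) by (intro that[of "{..<2 * (s k - 1)}" c \<mu>]) simp_all
qed

section \<open>Palindromic polynomials\<close>

text \<open>
  The polynomial identity \<open>x\<^sup>M p(1/x) = p(x)\<close>. The number \<open>M\<close> is a parameter, and not the degree of
  \<open>p\<close>, because the numerator and the denominator of an invariant quotient have to share it and the
  numerator vanishes at \<open>0\<close>.
\<close>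

definition palindromic :: "nat \<Rightarrow> 'a::zero poly \<Rightarrow> bool" where
  "palindromic M p \<longleftrightarrow> degree p \<le> M \<and> (\<forall>i\<le>M. coeff p (M - i) = coeff p i)"

lemma poly_eq_sum_atMost:
  fixes p :: "'a::comm_semiring_1 poly"
  assumes "degree p \<le> M"
  shows "poly p x = (\<Sum>i\<le>M. coeff p i * x ^ i)"
  unfolding poly_altdef using assms
  by (intro sum.mono_neutral_left) (auto simp: coeff_eq_0)

lemma poly_palindromic_inverse:
  fixes p :: "'a::field poly"
  assumes p: "palindromic M p" and x: "x \<noteq> 0"
  shows "poly p (1 / x) = poly p x / x ^ M"
proof -
  have deg: "degree p \<le> M" and sym: "\<And>i. i \<le> M \<Longrightarrow> coeff p (M - i) = coeff p i"
    using p by (auto simp: palindromic_def)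
  have "poly p (1 / x) = (\<Sum>i\<le>M. coeff p i * (1 / x) ^ i)"
    by (rule poly_eq_sum_atMost[OF deg])
  also have "\<dots> = (\<Sum>i\<le>M. coeff p (M - i) * (1 / x) ^ (M - i))"
    by (rule sum.atLeastAtMost_rev[of "\<lambda>i. coeff p i * (1 / x) ^ i" 0 M, simplified, unfolded atMost_atLeast0[symmetric]])
  also have "\<dots> = (\<Sum>i\<le>M. coeff p i * x ^ i / x ^ M)"
    using x by (intro sum.cong refl) (simp add: sym power_one_over power_diff field_simps)
  also have "\<dots> = poly p x / x ^ M"
    by (simp add: poly_eq_sum_atMost[OF deg] sum_divide_distrib)
  finally show ?thesis .
qed

lemma poly_eq_if_cofinite:
  fixes p q :: "complex poly"
  assumes "finite Z" "\<And>x. x \<notin> Z \<Longrightarrow> poly p x = poly q x"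
  shows "p = q"
proof (rule ccontr)
  assume "p \<noteq> q"
  then have "finite {x. poly (p - q) x = 0}"
    by (intro poly_roots_finite) simp
  moreover have "UNIV - Z \<subseteq> {x. poly (p - q) x = 0}"
    using assms(2) by auto
  ultimately have "finite (UNIV - Z)"
    by (rule rev_finite_subset)
  then show False
    using assms(1) infinite_UNIV_char_0 by (metis finite_Diff2)
qed

text \<open>
  Finitely many exceptions are allowed, so that the hypothesis can be checked with partial
  fractions away from their poles.
\<close>

lemma palindromicI:
  fixes p :: "complex poly"
  assumes deg: "degree p \<le> M" and Z: "finite Z"
    and eq: "\<And>x. x \<notin> Z \<Longrightarrow> x \<noteq> 0 \<Longrightarrow> x ^ M * poly p (1 / x) = poly p x"
  shows "palindromic M p"
proof -
  define q where "q = (\<Sum>i\<le>M. monom (coeff p (M - i)) i)"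
  have "q = p"
  proof (rule poly_eq_if_cofinite[of "insert 0 Z"])
    fix x assume x: "x \<notin> insert 0 Z"
    have "poly q x = (\<Sum>i\<le>M. coeff p (M - i) * x ^ i)"
      by (simp add: q_def poly_sum poly_monom)
    also have "\<dots> = (\<Sum>i\<le>M. coeff p (M - i) * x ^ M * (1 / x) ^ (M - i))"
      using x by (intro sum.cong refl) (simp add: power_one_over power_diff field_simps)
    also have "\<dots> = (\<Sum>i\<le>M. coeff p i * x ^ M * (1 / x) ^ i)"
      by (rule sum.atLeastAtMost_rev[of "\<lambda>i. coeff p i * x ^ M * (1 / x) ^ i" 0 M, simplified, unfolded atMost_atLeast0[symmetric], symmetric])
    also have "\<dots> = x ^ M * poly p (1 / x)"
      by (simp add: poly_eq_sum_atMost[OF deg] sum_distrib_left mult_ac)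
    also have "\<dots> = poly p x"
      using x by (intro eq) auto
    finally show "poly q x = poly p x" .
  qed (use Z in auto)
  moreover have "coeff q i = coeff p (M - i)" if "i \<le> M" for i
    using that by (simp add: q_def coeff_sum)
  ultimately show ?thesis
    using deg unfolding palindromic_def by metis
qed

lemma palindromic_map_poly:
  assumes "palindromic M p" "f 0 = 0"
  shows "palindromic M (map_poly f p)"
  using assms by (auto simp: palindromic_def coeff_map_poly coeff_eq_0 intro!: degree_le)

lemma palindromic_smult:
  assumes "palindromic M p"
  shows "palindromic M (Polynomial.smult c p)"
  using assms degree_smult_le[of c p] by (auto simp: palindromic_def)

text \<open>
  Both the numerator and the denominator acquire the same factor \<open>x\<^bsup>-M\<^esup>\<close>.
\<close>

lemma ratfun_palindromic:
  assumes "palindromic M P" "palindromic M Q"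
  shows "ratfun P Q ratfun_X = ratfun P Q (1 / ratfun_X)"
proof -
  have X: "ratfun_X \<noteq> 0"
    by (simp add: ratfun_X_def Zero_fract_def eq_fract)
  have "palindromic M (map_poly of_int P :: int poly fract poly)"
    "palindromic M (map_poly of_int Q :: int poly fract poly)"
    using assms by (auto intro: palindromic_map_poly)
  then show ?thesis
    using X by (simp add: ratfun_def poly_palindromic_inverse)
qed

section \<open>Descent of a quotient from the complex numbers to the integers\<close>

text \<open>
  Extend \<open>1\<close> to a basis of \<open>\<complex>\<close> over \<open>\<rat>\<close> and take the coordinate of \<open>1\<close>.
\<close>

lemma rational_functional:
  obtains \<phi> :: "complex \<Rightarrow> rat" where
    "\<And>x y. \<phi> (x + y) = \<phi> x + \<phi> y" "\<And>q x. \<phi> (of_rat q * x) = q * \<phi> x" "\<phi> 1 = 1"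
proof -
  interpret vector_space "\<lambda>q z. of_rat q * z :: complex"
    by standard (auto simp: algebra_simps of_rat_add of_rat_mult)
  have ind: "independent {1 :: complex}"
    by (simp add: dependent_single)
  define B where "B = extend_basis {1 :: complex}"
  have B: "independent B" "span B = UNIV" "1 \<in> B"
    using independent_extend_basis[OF ind] span_extend_basis[OF ind] extend_basis_superset[OF ind]
    by (auto simp: B_def)
  show ?thesis
  proof
    show "representation B (x + y) 1 = representation B x 1 + representation B y 1" for x y
      using B by (simp add: representation_add)
    show "representation B (of_rat q * x) 1 = q * representation B x 1" for q x
      using B by (simp add: representation_scale)
    show "representation B 1 1 = 1"
      using B by (simp add: representation_basis)
  qed
qed

lemma clear_denominators:
  fixes p :: "rat poly"
  obtains d :: int and q where "d \<noteq> 0" "map_poly of_int q = Polynomial.smult (of_int d) p"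
proof -
  have "\<exists>d::int. \<exists>q. d \<noteq> 0 \<and> map_poly of_int q = Polynomial.smult (of_int d) p"
  proof (induction p)
    case (pCons a p)
    then obtain d :: int and q where dq: "d \<noteq> 0" "map_poly of_int q = Polynomial.smult (of_int d) p"
      by blast
    obtain u v :: int where uv: "a = of_int u / of_int v" "v \<noteq> 0"
      by (metis Rat_cases Fract_of_int_quotient less_numeral_extra(3))
    have "map_poly of_int (pCons (u * d) (Polynomial.smult v q)) = Polynomial.smult (of_int (v * d)) (pCons a p)"
      using dq uv by (intro poly_eqI)
        (auto simp: coeff_map_poly coeff_pCons poly_eq_iff algebra_simps split: nat.split)
    then show ?case
      using dq uv by (intro exI[of _ "v * d"] exI) auto
  next
    case 0
    show ?case by (intro exI[of _ 1] exI[of _ 0]) simp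
  qed
  then show ?thesis using that by blast
qed

text \<open>
  The relation \<open>F B = A\<close> is a system of equations between the coefficients of \<open>A\<close> and \<open>B\<close> that are
  linear over \<open>\<rat>\<close>, since \<open>F\<close> has rational coefficients. A \<open>\<rat>\<close>-linear functional therefore turns
  \<open>A\<close> and \<open>B\<close> into rational polynomials with the same relation. That it maps \<open>1\<close> to \<open>1\<close> keeps the
  constant coefficient of the denominator different from zero.
\<close>

lemma palindromic_quotient_descent:
  fixes F :: "rat fps" and A B :: "complex poly"
  assumes F: "Abs_fps (\<lambda>n. of_rat (fps_nth F n)) * fps_of_poly B = fps_of_poly A"
    and B: "coeff B 0 = 1" and pal: "palindromic M A" "palindromic M B"
  shows "\<exists>P Q. expands_quotient F P Q \<and> palindromic M P \<and> palindromic M Q"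
proof -
  obtain \<phi> :: "complex \<Rightarrow> rat" where phi_add: "\<And>x y. \<phi> (x + y) = \<phi> x + \<phi> y"
    and phi_scale: "\<And>q x. \<phi> (of_rat q * x) = q * \<phi> x" and phi_1: "\<phi> 1 = 1"
    using rational_functional by blast
  have phi_0: "\<phi> 0 = 0"
    using phi_add[of 0 0] by simp
  have phi_sum: "\<phi> (sum f S) = (\<Sum>i\<in>S. \<phi> (f i))" for f and S :: "nat set"
    by (induction S rule: infinite_finite_induct) (auto simp: phi_0 phi_add)
  define A' B' where "A' = map_poly \<phi> A" and "B' = map_poly \<phi> B"
  have FB: "F * fps_of_poly B' = fps_of_poly A'"
  proof (rule fps_ext)
    fix n
    have "(\<Sum>i=0..n. of_rat (fps_nth F i) * coeff B (n - i)) = coeff A n"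
      using arg_cong[OF F, of "\<lambda>f. fps_nth f n"] by (simp add: fps_mult_nth)
    from arg_cong[OF this, of \<phi>]
    show "fps_nth (F * fps_of_poly B') n = fps_nth (fps_of_poly A') n"
      by (simp add: fps_mult_nth phi_sum phi_scale A'_def B'_def coeff_map_poly phi_0)
  qed
  obtain d P where P: "d \<noteq> 0" "map_poly of_int P = Polynomial.smult (of_int d) A'"
    by (rule clear_denominators)
  obtain e Q where Q: "e \<noteq> 0" "map_poly of_int Q = Polynomial.smult (of_int e) B'"
    by (rule clear_denominators)
  have P': "map_poly rat_of_int (Polynomial.smult e P) = Polynomial.smult (of_int (e * d)) A'"
    using P by (simp add: poly_eq_iff coeff_map_poly)
  have Q': "map_poly rat_of_int (Polynomial.smult d Q) = Polynomial.smult (of_int (e * d)) B'"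
    using Q by (simp add: poly_eq_iff coeff_map_poly)
  have "coeff (map_poly rat_of_int (Polynomial.smult d Q)) 0 = of_int (e * d)"
    unfolding Q' by (simp add: B'_def coeff_map_poly phi_0 B phi_1)
  then have Q0: "coeff (Polynomial.smult d Q) 0 \<noteq> 0"
    using P(1) Q(1) by (simp add: coeff_map_poly)
  have "F * fps_of_poly (map_poly of_int (Polynomial.smult d Q)) = fps_of_poly (map_poly of_int (Polynomial.smult e P))"
    unfolding P' Q' using FB by (simp add: fps_of_poly_smult mult_ac)
  moreover have "fps_of_poly (map_poly rat_of_int (Polynomial.smult d Q)) \<noteq> 0"
  proof
    assume "fps_of_poly (map_poly rat_of_int (Polynomial.smult d Q)) = 0"
    from arg_cong[OF this, of "\<lambda>f. fps_nth f 0"] show False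
      using Q0 by (simp add: coeff_map_poly)
  qed
  ultimately have "F = fps_of_poly (map_poly of_int (Polynomial.smult e P)) / fps_of_poly (map_poly of_int (Polynomial.smult d Q))"
    by (metis nonzero_mult_div_cancel_right)
  moreover have "palindromic M (Polynomial.smult e P)"
  proof -
    have "palindromic M (map_poly rat_of_int (Polynomial.smult e P))"
      unfolding P' A'_def using pal phi_0 by (intro palindromic_smult palindromic_map_poly)
    then show ?thesis by (auto simp: palindromic_def coeff_map_poly degree_map_poly simp del: coeff_smult)
  qed
  moreover have "palindromic M (Polynomial.smult d Q)"
  proof -
    have "palindromic M (map_poly rat_of_int (Polynomial.smult d Q))"
      unfolding Q' B'_def using pal phi_0 by (intro palindromic_smult palindromic_map_poly)
    then show ?thesis by (auto simp: palindromic_def coeff_map_poly degree_map_poly simp del: coeff_smult)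
  qed
  ultimately show ?thesis
    using Q0 unfolding expands_quotient_def by blast
qed

section \<open>Generating functions of symmetric exponential sums\<close>

text \<open>
  Multiplication by \<open>1 - \<mu> x\<close> takes the coefficients \<open>n \<mu>\<^sup>n\<close> to \<open>\<mu>\<^sup>n\<close> without the constant term,
  and the second multiplication leaves only the first term of this geometric series.
\<close>

lemma fps_linear_power_sum:
  fixes \<mu> :: "'a::comm_ring_1"
  shows "Abs_fps (\<lambda>n. of_nat n * \<mu> ^ n) * fps_of_poly ([:1, -\<mu>:] ^ 2) = fps_of_poly [:0, \<mu>:]"
proof -
  have mult: "fps_nth (G * fps_of_poly [:1, -\<mu>:]) n =
      fps_nth G n - (if n = 0 then 0 else \<mu> * fps_nth G (n - 1))" for G :: "'a fps" and n
    by (simp add: fps_of_poly_pCons algebra_simps)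
  have "Abs_fps (\<lambda>n. of_nat n * \<mu> ^ n) * fps_of_poly [:1, -\<mu>:] =
      Abs_fps (\<lambda>n. if n = 0 then 0 else \<mu> ^ n)"
  proof (rule fps_ext)
    fix n
    show "fps_nth (Abs_fps (\<lambda>n. of_nat n * \<mu> ^ n) * fps_of_poly [:1, -\<mu>:]) n =
        fps_nth (Abs_fps (\<lambda>n. if n = 0 then 0 else \<mu> ^ n)) n"
      unfolding mult by (cases n) (simp_all add: algebra_simps)
  qed
  moreover have "Abs_fps (\<lambda>n. if n = 0 then 0 else \<mu> ^ n) * fps_of_poly [:1, -\<mu>:] =
      fps_of_poly [:0, \<mu>:]"
  proof (rule fps_ext)
    fix n
    show "fps_nth (Abs_fps (\<lambda>n. if n = 0 then 0 else \<mu> ^ n) * fps_of_poly [:1, -\<mu>:]) n =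
        fps_nth (fps_of_poly [:0, \<mu>:]) n"
      unfolding mult by (cases n; cases "n - 1") (simp_all add: coeff_pCons)
  qed
  ultimately have "Abs_fps (\<lambda>n. of_nat n * \<mu> ^ n) * fps_of_poly [:1, -\<mu>:] * fps_of_poly [:1, -\<mu>:]
      = fps_of_poly [:0, \<mu>:]"
    by simp
  then show ?thesis
    by (simp only: power2_eq_square fps_of_poly_mult mult.assoc)
qed

text \<open>
  The power series is \<open>\<Sum>\<^sub>i c\<^sub>i \<mu>\<^sub>i x / (1 - \<mu>\<^sub>i x)\<^sup>2\<close>, and inserting \<open>1/x\<close> turns the summand of \<open>i\<close> into
  that of \<open>\<sigma> i\<close>. The common denominator \<open>B\<close> is itself palindromic, because the \<open>\<mu>\<^sub>i\<close> are permuted by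
  inversion and the product of their squares is \<open>1\<close>; hence the numerator \<open>A\<close> is palindromic too.
\<close>

theorem symmetric_quotient_of_exponential_sum:
  fixes c \<mu> :: "'i \<Rightarrow> complex" and \<sigma> :: "'i \<Rightarrow> 'i" and F :: "rat fps"
  assumes I: "finite I" and \<sigma>: "bij_betw \<sigma> I I"
    and inv: "\<And>i. i \<in> I \<Longrightarrow> \<mu> i * \<mu> (\<sigma> i) = 1" and c: "\<And>i. i \<in> I \<Longrightarrow> c (\<sigma> i) = c i"
    and F: "\<And>n. of_rat (fps_nth F n) = of_nat n * (\<Sum>i\<in>I. c i * \<mu> i ^ n)"
  shows "\<exists>P Q. expands_quotient F P Q \<and> ratfun P Q ratfun_X = ratfun P Q (1 / ratfun_X)"
proof -
  define M where "M = 2 * card I"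
  define q where "q i = [:1, - \<mu> i:] ^ 2" for i
  define B where "B = (\<Prod>i\<in>I. q i)"
  define A where "A = (\<Sum>i\<in>I. Polynomial.smult (c i) ([:0, \<mu> i:] * (\<Prod>j\<in>I - {i}. q j)))"
  have B_split: "B = q i * (\<Prod>j\<in>I - {i}. q j)" if "i \<in> I" for i
    unfolding B_def by (rule prod.remove[OF I that])
  have "Abs_fps (\<lambda>n. of_rat (fps_nth F n)) = (\<Sum>i\<in>I. fps_const (c i) * Abs_fps (\<lambda>n. of_nat n * \<mu> i ^ n))"
    by (rule fps_ext) (simp add: F fps_sum_nth sum_distrib_left mult_ac)
  then have "Abs_fps (\<lambda>n. of_rat (fps_nth F n)) * fps_of_poly B =
      (\<Sum>i\<in>I. fps_const (c i) * Abs_fps (\<lambda>n. of_nat n * \<mu> i ^ n) * fps_of_poly B)"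
    by (simp only: sum_distrib_right)
  also have "\<dots> = (\<Sum>i\<in>I. fps_of_poly (Polynomial.smult (c i) ([:0, \<mu> i:] * (\<Prod>j\<in>I - {i}. q j))))"
  proof (rule sum.cong[OF refl])
    fix i assume i: "i \<in> I"
    have "fps_const (c i) * Abs_fps (\<lambda>n. of_nat n * \<mu> i ^ n) * fps_of_poly B =
        fps_const (c i) * (Abs_fps (\<lambda>n. of_nat n * \<mu> i ^ n) * fps_of_poly (q i))
          * fps_of_poly (\<Prod>j\<in>I - {i}. q j)"
      unfolding B_split[OF i] by (simp only: fps_of_poly_mult mult.assoc)
    also have "\<dots> = fps_of_poly (Polynomial.smult (c i) ([:0, \<mu> i:] * (\<Prod>j\<in>I - {i}. q j)))"
      unfolding q_def fps_linear_power_sum by (simp only: fps_of_poly_smult fps_of_poly_mult mult.assoc)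
    finally show "fps_const (c i) * Abs_fps (\<lambda>n. of_nat n * \<mu> i ^ n) * fps_of_poly B =
        fps_of_poly (Polynomial.smult (c i) ([:0, \<mu> i:] * (\<Prod>j\<in>I - {i}. q j)))" .
  qed
  also have "\<dots> = fps_of_poly A"
    by (simp only: A_def fps_of_poly_sum)
  finally have FB: "Abs_fps (\<lambda>n. of_rat (fps_nth F n)) * fps_of_poly B = fps_of_poly A" .

  have B0: "coeff B 0 = 1"
    by (simp add: B_def q_def poly_prod flip: poly_0_coeff_0)
  have degq: "degree (q i) \<le> 2" for i
    unfolding q_def by (rule order.trans[OF degree_power_le]) simp
  have deg_prod: "degree (\<Prod>i\<in>J. q i) \<le> 2 * card J" for J
  proof (induction J rule: infinite_finite_induct)
    case (insert i J)
    then show ?case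
      using degree_mult_le[of "q i" "\<Prod>i\<in>J. q i"] degq[of i] by simp
  qed auto
  have degB: "degree B \<le> M"
    unfolding B_def M_def by (rule deg_prod)
  have degA: "degree A \<le> M"
    unfolding A_def
  proof (intro degree_sum_le I order.trans[OF degree_smult_le])
    fix i assume "i \<in> I"
    have "degree ([:0, \<mu> i:] * (\<Prod>j\<in>I - {i}. q j)) \<le> 1 + 2 * card (I - {i})"
      by (rule order.trans[OF degree_mult_le]) (intro add_mono deg_prod, simp)
    also have "\<dots> \<le> M"
      using card_Suc_Diff1[OF I \<open>i \<in> I\<close>] by (simp add: M_def)
    finally show "degree ([:0, \<mu> i:] * (\<Prod>j\<in>I - {i}. q j)) \<le> M" .
  qed
  have \<mu>0: "\<mu> i \<noteq> 0" if "i \<in> I" for i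
    using inv[OF that] by auto
  have \<sigma>I: "\<sigma> i \<in> I" if "i \<in> I" for i
    using \<sigma> that by (auto simp: bij_betw_def)
  have \<mu>\<sigma>: "\<mu> (\<sigma> i) = 1 / \<mu> i" if "i \<in> I" for i
    using inv[OF that] \<mu>0[OF that] by (simp add: field_simps)
  have prod\<mu>: "(\<Prod>i\<in>I. (\<mu> i)\<^sup>2) = 1"
  proof -
    have "(\<Prod>i\<in>I. (\<mu> i)\<^sup>2) = (\<Prod>i\<in>I. \<mu> i) * (\<Prod>i\<in>I. \<mu> (\<sigma> i))"
      using prod.reindex_bij_betw[OF \<sigma>, of \<mu>] by (simp add: power2_eq_square prod.distrib)
    also have "\<dots> = 1"
      by (simp add: prod.distrib[symmetric] inv)
    finally show ?thesis .
  qed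
  have recB: "x ^ M * poly B (1 / x) = poly B x" if x: "x \<noteq> 0" for x
  proof -
    have "x ^ M * poly B (1 / x) = (\<Prod>i\<in>I. x\<^sup>2 * (1 - \<mu> i / x)\<^sup>2)"
      by (simp add: M_def B_def q_def poly_prod prod.distrib power_mult)
    also have "\<dots> = (\<Prod>i\<in>I. (\<mu> i)\<^sup>2 * (1 - \<mu> (\<sigma> i) * x)\<^sup>2)"
      using x \<mu>0 by (intro prod.cong refl) (simp add: \<mu>\<sigma> power2_eq_square field_simps)
    also have "\<dots> = (\<Prod>i\<in>I. (1 - \<mu> (\<sigma> i) * x)\<^sup>2)"
      by (simp add: prod.distrib prod\<mu>)
    also have "\<dots> = poly B x"
      using prod.reindex_bij_betw[OF \<sigma>, of "\<lambda>i. (1 - \<mu> i * x)\<^sup>2"]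
      by (simp add: B_def q_def poly_prod mult.commute)
    finally show ?thesis .
  qed
  have A_over_B: "poly A x = poly B x * (\<Sum>i\<in>I. c i * \<mu> i * x / (1 - \<mu> i * x)\<^sup>2)"
    if x: "\<And>i. i \<in> I \<Longrightarrow> 1 - \<mu> i * x \<noteq> 0" for x
  proof -
    have "poly (Polynomial.smult (c i) ([:0, \<mu> i:] * (\<Prod>j\<in>I - {i}. q j))) x =
        poly B x * (c i * \<mu> i * x / (1 - \<mu> i * x)\<^sup>2)" if "i \<in> I" for i
      using x[OF that] unfolding B_split[OF that] by (simp add: q_def field_simps)
    then show ?thesis
      by (simp only: A_def poly_sum sum_distrib_left cong: sum.cong)
  qed
  have recA: "x ^ M * poly A (1 / x) = poly A x"
    if x: "x \<notin> \<mu> ` I" "x \<notin> (\<lambda>i. 1 / \<mu> i) ` I" "x \<noteq> 0" for x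
  proof -
    have nz: "1 - \<mu> i * x \<noteq> 0" "1 - \<mu> i * (1 / x) \<noteq> 0" "x - \<mu> i \<noteq> 0" if "i \<in> I" for i
    proof -
      have "x \<noteq> \<mu> i" "x \<noteq> 1 / \<mu> i"
        using x that by blast+
      then show "1 - \<mu> i * x \<noteq> 0" "1 - \<mu> i * (1 / x) \<noteq> 0" "x - \<mu> i \<noteq> 0"
        using x(3) \<mu>0[OF that] by (auto simp: field_simps)
    qed
    have "(\<Sum>i\<in>I. c i * \<mu> i * (1 / x) / (1 - \<mu> i * (1 / x))\<^sup>2) =
        (\<Sum>i\<in>I. c (\<sigma> i) * \<mu> (\<sigma> i) * x / (1 - \<mu> (\<sigma> i) * x)\<^sup>2)"
    proof (intro sum.cong refl)
      fix i assume i: "i \<in> I"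
      have 1: "1 - \<mu> i * (1 / x) = - (\<mu> i / x) * (1 - \<mu> (\<sigma> i) * x)"
        using x(3) \<mu>0[OF i] by (simp add: \<mu>\<sigma>[OF i] field_simps)
      have 2: "1 - \<mu> (\<sigma> i) * x \<noteq> 0"
        using nz(1) \<sigma>I[OF i] by blast
      show "c i * \<mu> i * (1 / x) / (1 - \<mu> i * (1 / x))\<^sup>2 =
          c (\<sigma> i) * \<mu> (\<sigma> i) * x / (1 - \<mu> (\<sigma> i) * x)\<^sup>2"
        unfolding 1 c[OF i] power_mult_distrib using x(3) \<mu>0[OF i] 2
        by (simp add: \<mu>\<sigma>[OF i] power2_eq_square)
    qed
    also have "\<dots> = (\<Sum>i\<in>I. c i * \<mu> i * x / (1 - \<mu> i * x)\<^sup>2)"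
      by (rule sum.reindex_bij_betw[OF \<sigma>])
    finally show ?thesis
      using A_over_B[of x] A_over_B[of "1 / x"] nz recB[OF x(3)] by (simp add: mult.assoc[symmetric])
  qed
  have "palindromic M B"
    using degB recB by (intro palindromicI[of B M "{}"]) auto
  moreover have "palindromic M A"
    using degA recA I by (intro palindromicI[of A M "\<mu> ` I \<union> (\<lambda>i. 1 / \<mu> i) ` I"]) auto
  ultimately obtain P Q where "expands_quotient F P Q" "palindromic M P" "palindromic M Q"
    using palindromic_quotient_descent[OF FB B0] by blast
  then show ?thesis
    using ratfun_palindromic by blast
qed

theorem theorem3:
  fixes k :: nat and s :: "nat \<Rightarrow> nat"
  assumes "k \<ge> 1"
    and "s 1 \<ge> 1"
    and "strict_mono_on {1..k} s"
    and "Gcd (s ` {1..k}) = 1"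
  shows "\<exists>P Q :: int poly.
           expands_quotient (tau_gf k s) P Q \<and>
           ratfun P Q ratfun_X = ratfun P Q (1 / ratfun_X)"
proof (rule tau_exponential_sum[OF assms(1-3)])
  fix c \<mu> :: "nat set \<Rightarrow> complex" and N :: "nat set"
  assume N: "finite N"
    and tau: "\<And>n. n \<ge> 1 \<Longrightarrow> of_nat (tau k s n) = of_nat n * (\<Sum>X\<in>Pow N. c X * \<mu> X ^ n)"
    and c: "\<And>X. X \<subseteq> N \<Longrightarrow> c (N - X) = c X"
    and \<mu>: "\<And>X. X \<subseteq> N \<Longrightarrow> \<mu> X * \<mu> (N - X) = 1"
  show ?thesis
  proof (rule symmetric_quotient_of_exponential_sum)
    show "bij_betw (\<lambda>X. N - X) (Pow N) (Pow N)"
      by (rule bij_betw_byWitness[where f' = "\<lambda>X. N - X"]) auto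
    show "of_rat (fps_nth (tau_gf k s) n) = of_nat n * (\<Sum>X\<in>Pow N. c X * \<mu> X ^ n)" for n
      using tau[of n] by (cases "n = 0") (simp_all add: tau_gf_def)
  qed (use N c \<mu> in auto)
qed

end
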